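(* There exists a unique function $\varphi\in\mathcal{AC}$ satisfying the Zachrisson equation with unilateral constraints, that is, a unique $\varphi\in\mathcal{AC}$ such that for each $i\in\mathcal{S}$: (Z1) $\varphi(T,i)=g(T,i)$; (Z2) $\varphi(t,i)\le g(t,i)$ for all $t\in[0,T]$; (Z3) at every $t\in[0,T]$ where $\frac{d}{dt}\varphi(t,i)$ exists and $\varphi(t,i)<g(t,i)$, one has $\frac{d}{dt}\varphi(t,i)\le -H_i(t,\varphi(t))$; (Z4) at every $t\in[0,T]$ where $\varphi(\cdot,i)$ is differentiable, one has $\frac{d}{dt}\varphi(t,i)\ge -H_i(t,\varphi(t))$.
   Context: $T>0$; $\mathcal{S}=\{1,\dots,d\}$; $U,V$ are control spaces; for $(t,u,v)\in[0,T]\times U\times V$, $Q(t,u,v)=(Q_{i,j}(t,u,v))_{i,j=1}^d$ is a Kolmogorov matrix, i.e. $Q_{i,j}(t,u,v)\ge 0$ for $i\ne j$ and $\sum_{j\in\mathcal{S}}Q_{i,j}(t,u,v)=0$; $g:[0,T]\times\mathcal{S}\to\mathbb{R}$ and $h:[0,T]\times\mathcal{S}\times U\times V\to\mathbb{R}$. Standing assumptions: (1) $U$ and $V$ are compact; (2) $Q_{i,j}$, $g(\cdot,i)$ and $h(\cdot,i,\cdot,\cdot)$ are continuous for all $i,j$; (3) $g$ is Lipschitz continuous in the time variable; (4) for all $t\in[0,T]$, $i\in\mathcal{S}$, $w\in\mathbb{R}^d$, $$\min_{u\in U}\max_{v\in V}\Bigl[\sum_{j\in\mathcal{S}}Q_{i,j}(t,u,v)w_j+h(t,i,u,v)\Bigr]=\max_{v\in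 V}\min_{u\in U}\Bigl[\sum_{j\in\mathcal{S}}Q_{i,j}(t,u,v)w_j+h(t,i,u,v)\Bigr].$$ The common value is denoted $H_i(t,w)$. $\mathcal{AC}$ is the set of functions $\phi:[0,T]\times\mathcal{S}\to\mathbb{R}$ such that $t\mapsto\phi(t,i)$ is absolutely continuous for each $i\in\mathcal{S}$; $\phi(t)$ denotes the vector $(\phi(t,1),\dots,\phi(t,d))^T$. *)

theory Defs
  imports "HOL-Analysis.Analysis"
begin

text \<open>The state space is the index type \<open>'d\<close> (class \<open>finite\<close>), so vectors in
  \<open>\<real>\<^sup>d\<close> have type \<open>real ^ 'd\<close>; \<open>Q t u v $ i $ j\<close> is the entry in row \<open>i\<close> and column \<open>j\<close>.\<close>

definition kolmogorov_matrix :: "real ^ 'd ^ 'd \<Rightarrow> bool" where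
  "kolmogorov_matrix A \<longleftrightarrow>
     (\<forall>i j. i \<noteq> j \<longrightarrow> 0 \<le> A $ i $ j) \<and> (\<forall>i. (\<Sum>j\<in>UNIV. A $ i $ j) = 0)"

definition pre_hamiltonian ::
  "(real \<Rightarrow> 'u \<Rightarrow> 'v \<Rightarrow> real ^ 'd ^ 'd) \<Rightarrow> (real \<Rightarrow> 'd \<Rightarrow> 'u \<Rightarrow> 'v \<Rightarrow> real)
     \<Rightarrow> real \<Rightarrow> 'd \<Rightarrow> real ^ 'd \<Rightarrow> 'u \<Rightarrow> 'v \<Rightarrow> real" where
  "pre_hamiltonian Q h t i w u v = (\<Sum>j\<in>UNIV. Q t u v $ i $ j * w $ j) + h t i u v"

text \<open>\<open>Min\<close> and \<open>Max\<close> of the library are for finite sets, hence \<open>INF\<close> and \<open>SUP\<close> below.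
  For nonempty compact \<open>U\<close>, \<open>V\<close> and a jointly continuous payoff all these extrema are
  attained: see \<open>minmax_attained\<close> and \<open>maxmin_attained\<close>.\<close>

definition minmax :: "'u set \<Rightarrow> 'v set \<Rightarrow> ('u \<Rightarrow> 'v \<Rightarrow> real) \<Rightarrow> real" where
  "minmax U V F = (INF u\<in>U. SUP v\<in>V. F u v)"

definition maxmin :: "'u set \<Rightarrow> 'v set \<Rightarrow> ('u \<Rightarrow> 'v \<Rightarrow> real) \<Rightarrow> real" where
  "maxmin U V F = (SUP v\<in>V. INF u\<in>U. F u v)"

definition hamiltonian ::
  "'u set \<Rightarrow> 'v set \<Rightarrow> (real \<Rightarrow> 'u \<Rightarrow> 'v \<Rightarrow> real ^ 'd ^ 'd)
     \<Rightarrow> (real \<Rightarrow> 'd \<Rightarrow> 'u \<Rightarrow> 'v \<Rightarrow> real) \<Rightarrow> 'd \<Rightarrow> real \<Rightarrow> real ^ 'd \<Rightarrow> real" where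
  "hamiltonian U V Q h i t w = minmax U V (pre_hamiltonian Q h t i w)"

definition absolutely_continuous_on :: "real set \<Rightarrow> (real \<Rightarrow> real) \<Rightarrow> bool" where
  "absolutely_continuous_on S f \<longleftrightarrow>
     (\<forall>\<epsilon>>0. \<exists>\<delta>>0. \<forall>(n::nat) a b.
        (\<forall>k<n. a k \<le> b k \<and> {a k..b k} \<subseteq> S) \<and>
        (\<forall>k<n. \<forall>l<n. k \<noteq> l \<longrightarrow> {a k<..<b k} \<inter> {a l<..<b l} = {}) \<and>
        (\<Sum>k<n. b k - a k) < \<delta>
        \<longrightarrow> (\<Sum>k<n. \<bar>f (b k) - f (a k)\<bar>) < \<epsilon>)"

text \<open>A function on \<open>[0,T] \<times> S\<close> is represented by a curried function that is \<open>undefined\<close> for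
  times outside \<open>[0,T]\<close> (\<open>extensional\<close>), so that \<open>\<exists>!\<close> means uniqueness on \<open>[0,T] \<times> S\<close>.\<close>

definition AC :: "real \<Rightarrow> (real \<Rightarrow> 'd \<Rightarrow> real) set" where
  "AC T = {\<phi> \<in> extensional {0..T}. \<forall>i. absolutely_continuous_on {0..T} (\<lambda>t. \<phi> t i)}"

text \<open>Derivatives are taken within \<open>[0,T]\<close>, i.e. one-sided at the end points. For \<open>T > 0\<close> the
  derivative \<open>D\<close> at a point is unique whenever it exists.\<close>

definition zachrisson_solution ::
  "real \<Rightarrow> 'u set \<Rightarrow> 'v set \<Rightarrow> (real \<Rightarrow> 'u \<Rightarrow> 'v \<Rightarrow> real ^ 'd ^ 'd)
     \<Rightarrow> (real \<Rightarrow> 'd \<Rightarrow> 'u \<Rightarrow> 'v \<Rightarrow> real) \<Rightarrow> (real \<Rightarrow> 'd \<Rightarrow> real) \<Rightarrow> (real \<Rightarrow> 'd \<Rightarrow> real) \<Rightarrow> bool" where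
  "zachrisson_solution T U V Q h g \<phi> \<longleftrightarrow> (\<forall>i.
     \<phi> T i = g T i \<and>
     (\<forall>t\<in>{0..T}. \<phi> t i \<le> g t i) \<and>
     (\<forall>t\<in>{0..T}. \<forall>D. ((\<lambda>s. \<phi> s i) has_real_derivative D) (at t within {0..T}) \<and> \<phi> t i < g t i
        \<longrightarrow> D \<le> - hamiltonian U V Q h i t (\<chi> j. \<phi> t j)) \<and>
     (\<forall>t\<in>{0..T}. \<forall>D. ((\<lambda>s. \<phi> s i) has_real_derivative D) (at t within {0..T})
        \<longrightarrow> - hamiltonian U V Q h i t (\<chi> j. \<phi> t j) \<le> D))"

lemma SUP_attained:
  fixes f :: "'a::topological_space \<Rightarrow> real"
  assumes "compact A" "A \<noteq> {}" "continuous_on A f"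
  shows "\<exists>x\<in>A. f x = (SUP x\<in>A. f x) \<and> (\<forall>y\<in>A. f y \<le> f x)"
proof -
  obtain x where x: "x \<in> A" "\<forall>y\<in>A. f y \<le> f x"
    using continuous_attains_sup[OF assms] by blast
  then have "(SUP x\<in>A. f x) = f x"
    by (intro cSup_eq_maximum) auto
  with x show ?thesis by auto
qed

lemma minmax_attained:
  fixes F :: "'u::topological_space \<Rightarrow> 'v::topological_space \<Rightarrow> real"
  assumes U: "compact U" "U \<noteq> {}" and V: "compact V" "V \<noteq> {}"
    and F: "continuous_on (U \<times> V) (\<lambda>(u, v). F u v)"
  shows "\<And>u. u \<in> U \<Longrightarrow> \<exists>v\<in>V. F u v = (SUP v\<in>V. F u v) \<and> (\<forall>v'\<in>V. F u v' \<le> F u v)"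
    and "\<exists>u\<in>U. (SUP v\<in>V. F u v) = minmax U V F \<and> (\<forall>u'\<in>U. (SUP v\<in>V. F u v) \<le> (SUP v\<in>V. F u' v))"
proof -
  have cu: "continuous_on U (\<lambda>u. F u v)" if "v \<in> V" for v
  proof -
    have "continuous_on U (\<lambda>u. (u, v))" by (intro continuous_intros)
    from continuous_on_compose2[OF F this] that show ?thesis by auto
  qed
  have cv: "continuous_on V (F u)" if "u \<in> U" for u
  proof -
    have "continuous_on V (\<lambda>v. (u, v))" by (intro continuous_intros)
    from continuous_on_compose2[OF F this] that show ?thesis by auto
  qed
  show att: "\<exists>v\<in>V. F u v = (SUP v\<in>V. F u v) \<and> (\<forall>v'\<in>V. F u v' \<le> F u v)" if "u \<in> U" for u
    using SUP_attained[OF V cv[OF that]] .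
  define M where "M u = (SUP v\<in>V. F u v)" for u
  have le_M: "F u v \<le> M u" if "u \<in> U" "v \<in> V" for u v
    using att[OF that(1)] that(2) unfolding M_def by auto
  have "\<exists>u\<in>U. \<forall>u'\<in>U. M u \<le> M u'"
  proof (rule ccontr)
    assume "\<not> ?thesis"
    then have lt: "\<forall>u\<in>U. \<exists>u'\<in>U. M u' < M u" by (auto simp: not_le)
    have "\<forall>u\<in>U. \<exists>w W. w \<in> U \<and> open W \<and> u \<in> W \<and> (\<forall>x\<in>W \<inter> U. M w < M x)"
    proof
      fix u assume u: "u \<in> U"
      obtain w where w: "w \<in> U" "M w < M u" using lt u by blast
      obtain v where v: "v \<in> V" "F u v = M u" using att[OF u] unfolding M_def by blast
      obtain W where W: "open W" "W \<inter> U = (\<lambda>u. F u v) -` {M w<..} \<inter> U"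
        using cu[OF v(1)] open_greaterThan unfolding continuous_on_open_invariant by blast
      have "open W \<and> u \<in> W \<and> (\<forall>x\<in>W \<inter> U. M w < M x)"
      proof (intro conjI ballI)
        show "u \<in> W" using W(2) u v w by auto
        fix x assume x: "x \<in> W \<inter> U"
        then have "M w < F x v" using W(2) by auto
        also have "\<dots> \<le> M x" using le_M x v by auto
        finally show "M w < M x" .
      qed (fact W(1))
      then show "\<exists>w W. w \<in> U \<and> open W \<and> u \<in> W \<and> (\<forall>x\<in>W \<inter> U. M w < M x)"
        using w by blast
    qed
    then obtain w W where wW: "\<And>u. u \<in> U \<Longrightarrow> w u \<in> U \<and> open (W u) \<and> u \<in> W u \<and>
        (\<forall>x\<in>W u \<inter> U. M (w u) < M x)"
      by metis
    obtain C where C: "C \<subseteq> U" "finite C" "U \<subseteq> (\<Union>u\<in>C. W u)"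
      using compactE_image[OF U(1), of U W] wW by blast
    have "C \<noteq> {}" using C U by auto
    define c where "c = arg_min_on (\<lambda>c. M (w c)) C"
    have c: "c \<in> C" "\<forall>c'\<in>C. M (w c) \<le> M (w c')"
      unfolding c_def
      by (rule arg_min_if_finite(1)[OF C(2) \<open>C \<noteq> {}\<close>])
        (use arg_min_least[OF C(2) \<open>C \<noteq> {}\<close>, of _ "\<lambda>c. M (w c)"] in auto)
    have "w c \<in> U" using c C wW by blast
    then obtain c' where "c' \<in> C" "w c \<in> W c'" using C by blast
    then have "M (w c') < M (w c)" using wW[of c'] C(1) \<open>w c \<in> U\<close> by blast
    moreover have "M (w c) \<le> M (w c')" using c(2) \<open>c' \<in> C\<close> by blast
    ultimately show False by simp
  qed
  then obtain u where u: "u \<in> U" "\<forall>u'\<in>U. M u \<le> M u'" by blast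
  then have "minmax U V F = M u"
    unfolding minmax_def M_def[symmetric] by (intro cInf_eq_minimum) auto
  with u show "\<exists>u\<in>U. (SUP v\<in>V. F u v) = minmax U V F \<and>
      (\<forall>u'\<in>U. (SUP v\<in>V. F u v) \<le> (SUP v\<in>V. F u' v))"
    unfolding M_def by auto
qed

lemma maxmin_attained:
  fixes F :: "'u::topological_space \<Rightarrow> 'v::topological_space \<Rightarrow> real"
  assumes U: "compact U" "U \<noteq> {}" and V: "compact V" "V \<noteq> {}"
    and F: "continuous_on (U \<times> V) (\<lambda>(u, v). F u v)"
  shows "\<And>v. v \<in> V \<Longrightarrow> \<exists>u\<in>U. F u v = (INF u\<in>U. F u v) \<and> (\<forall>u'\<in>U. F u v \<le> F u' v)"
    and "\<exists>v\<in>V. (INF u\<in>U. F u v) = maxmin U V F \<and> (\<forall>v'\<in>V. (INF u\<in>U. F u v') \<le> (INF u\<in>U. F u v))"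
proof -
  define G where "G v u = - F u v" for v u
  have G: "continuous_on (V \<times> U) (\<lambda>(v, u). G v u)"
  proof -
    have "continuous_on (V \<times> U) (\<lambda>x. (snd x, fst x))" by (intro continuous_intros)
    from continuous_on_compose2[OF F this]
    have "continuous_on (V \<times> U) (\<lambda>x. F (snd x) (fst x))"
      by (simp add: image_subset_iff case_prod_beta)
    then show ?thesis by (auto simp: G_def case_prod_beta intro!: continuous_intros)
  qed
  have inf: "(INF u\<in>U. F u v) = - (SUP u\<in>U. G v u)" for v
    by (simp add: Inf_real_def image_image G_def)
  have mm: "maxmin U V F = - minmax V U G"
    unfolding maxmin_def minmax_def inf by (simp add: Inf_real_def image_image)
  show "\<exists>u\<in>U. F u v = (INF u\<in>U. F u v) \<and> (\<forall>u'\<in>U. F u v \<le> F u' v)" if "v \<in> V" for v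
  proof -
    obtain u where u: "u \<in> U" "G v u = (SUP u\<in>U. G v u)" "\<forall>u'\<in>U. G v u' \<le> G v u"
      using minmax_attained(1)[OF V U G \<open>v \<in> V\<close>] by blast
    have "F u v = (INF u\<in>U. F u v)" unfolding inf using u(2) by (simp add: G_def)
    moreover have "\<forall>u'\<in>U. F u v \<le> F u' v" using u(3) by (simp add: G_def)
    ultimately show ?thesis using u(1) by blast
  qed
  show "\<exists>v\<in>V. (INF u\<in>U. F u v) = maxmin U V F \<and> (\<forall>v'\<in>V. (INF u\<in>U. F u v') \<le> (INF u\<in>U. F u v))"
    using minmax_attained(2)[OF V U G] unfolding inf mm by auto
qed

end

theory Submission
  imports Defs
begin

text \<open>
  Write \<open>H\<^sub>i\<close> for the Hamiltonian. The point of the proof is that the unilateral equation is a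
  fixed point problem with an explicit operator. For one component, freeze the driver
  \<open>c(t) = H\<^sub>i(t, \<phi>(t))\<close>, a continuous function of time. The constraint \<open>y \<le> \<gamma>\<close> together with
  \<open>y' \<ge> - c\<close>, with equality where \<open>y < \<gamma>\<close>, is the equation of a deterministic optimal stopping
  problem, and its solution is
    \<open>y(t) = inf {\<gamma>(s) + \<integral> c over [t,s] | t \<le> s \<le> T}\<close>
  (\<open>stopping_value\<close>). Adding the primitive \<open>C\<close> of \<open>c\<close>, the formula says that \<open>y + C\<close> is the infimum
  of \<open>\<gamma> + C\<close> over \<open>[t,T]\<close>: a nondecreasing function of \<open>t\<close>, constant just after every time at
  which it lies strictly below \<open>\<gamma> + C\<close>, and Lipschitz because \<open>\<gamma>\<close> is. This gives existence for a
  frozen driver (\<open>stopping_value_imp_obstacle_solution\<close>). The stopping value depends on the driver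
  in a Lipschitz way and the Hamiltonian is Lipschitz in \<open>w\<close>, so in the norm weighted by
  \<open>exp (l t)\<close> with large \<open>l\<close> the resulting operator on continuous curves is a contraction
  (\<open>stopping_value_system_fixed_point\<close>).

  It remains to see that every absolutely continuous solution is a fixed point
  (\<open>obstacle_solution_imp_stopping_value\<close>). The equation constrains \<open>y\<close> only at the
  times where a derivative exists, so what is needed is that an absolutely continuous function
  whose derivative is nonnegative wherever it exists is nondecreasing
  (\<open>absolutely_continuous_nonneg_derivative_imp_le\<close>). This contains the almost everywhere
  differentiability of absolutely continuous functions, which is proved here directly from Vitali's
  covering theorem. If the points having arbitrarily short surrounding intervals of slope below \<open>p\<close>
  and others of slope above \<open>q > p\<close> formed a set of positive measure, then disjoint intervals of the
  first kind could be chosen to cover half of it, and inside them intervals of the second kind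
  leaving only gaps of small total length. Absolute continuity makes the increments over the gaps
  small, and the two slopes contradict each other (\<open>negligible_two_slopes\<close>). The same
  comparison of an increment with the increments over the gaps of a fine cover gives monotonicity.
\<close>

section \<open>Absolutely continuous functions\<close>

text \<open>Gaps between covering intervals come as families indexed by pairs of intervals, so the
  modulus of absolute continuity is needed for arbitrary finite index sets.\<close>

lemma absolutely_continuous_on_indexedE:
  assumes "absolutely_continuous_on S f" "\<epsilon> > 0"
  obtains \<delta> where "\<delta> > 0"
    "\<forall>(I::'i set) l r. finite I \<and> (\<forall>i\<in>I. l i \<le> r i \<and> {l i..r i} \<subseteq> S) \<and>
       (\<forall>i\<in>I. \<forall>j\<in>I. i \<noteq> j \<longrightarrow> {l i<..<r i} \<inter> {l j<..<r j} = {}) \<and>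
       (\<Sum>i\<in>I. r i - l i) < \<delta> \<longrightarrow> (\<Sum>i\<in>I. \<bar>f (r i) - f (l i)\<bar>) < \<epsilon>"
proof -
  obtain \<delta> where \<delta>: "\<delta> > 0" and ac: "\<And>(n::nat) a b.
        (\<forall>k<n. a k \<le> b k \<and> {a k..b k} \<subseteq> S) \<and>
        (\<forall>k<n. \<forall>l<n. k \<noteq> l \<longrightarrow> {a k<..<b k} \<inter> {a l<..<b l} = {}) \<and>
        (\<Sum>k<n. b k - a k) < \<delta>
        \<Longrightarrow> (\<Sum>k<n. \<bar>f (b k) - f (a k)\<bar>) < \<epsilon>"
    using assms unfolding absolutely_continuous_on_def by blast
  show ?thesis
  proof (rule that[OF \<delta>], intro allI impI, elim conjE)
    fix I :: "'i set" and l r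
    assume "finite I" and I: "\<forall>i\<in>I. l i \<le> r i \<and> {l i..r i} \<subseteq> S"
      and disj: "\<forall>i\<in>I. \<forall>j\<in>I. i \<noteq> j \<longrightarrow> {l i<..<r i} \<inter> {l j<..<r j} = {}"
      and len: "(\<Sum>i\<in>I. r i - l i) < \<delta>"
    obtain n :: nat and h where h: "bij_betw h {..<n} I"
      using ex_bij_betw_nat_finite[OF \<open>finite I\<close>] by (auto simp: atLeast0LessThan)
    have mem: "h k \<in> I" if "k < n" for k
      using h that by (auto simp: bij_betw_def)
    have ne: "h k \<noteq> h m" if "k < n" "m < n" "k \<noteq> m" for k m
      using h that by (auto simp: bij_betw_def inj_on_def)
    have "(\<Sum>k<n. \<bar>f (r (h k)) - f (l (h k))\<bar>) < \<epsilon>"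
    proof (rule ac, intro conjI allI impI)
      show "(\<Sum>k<n. r (h k) - l (h k)) < \<delta>"
        using len sum.reindex_bij_betw[OF h, of "\<lambda>i. r i - l i"] by simp
      show "{l (h k)<..<r (h k)} \<inter> {l (h m)<..<r (h m)} = {}"
        if "k < n" "m < n" "k \<noteq> m" for k m
        using disj mem ne that by blast
      show "l (h k) \<le> r (h k)" "{l (h k)..r (h k)} \<subseteq> S" if "k < n" for k
        using I mem[OF that] by auto
    qed
    then show "(\<Sum>i\<in>I. \<bar>f (r i) - f (l i)\<bar>) < \<epsilon>"
      using sum.reindex_bij_betw[OF h, of "\<lambda>i. \<bar>f (r i) - f (l i)\<bar>"] by simp
  qed
qed

lemma absolutely_continuous_on_subset:
  assumes "absolutely_continuous_on S f" "S' \<subseteq> S"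
  shows "absolutely_continuous_on S' f"
  unfolding absolutely_continuous_on_def
proof (intro allI impI)
  fix \<epsilon> :: real assume "\<epsilon> > 0"
  then obtain \<delta> where "\<delta> > 0" and ac: "\<forall>(n::nat) a b.
        (\<forall>k<n. a k \<le> b k \<and> {a k..b k} \<subseteq> S) \<and>
        (\<forall>k<n. \<forall>l<n. k \<noteq> l \<longrightarrow> {a k<..<b k} \<inter> {a l<..<b l} = {}) \<and>
        (\<Sum>k<n. b k - a k) < \<delta>
        \<longrightarrow> (\<Sum>k<n. \<bar>f (b k) - f (a k)\<bar>) < \<epsilon>"
    using assms(1) unfolding absolutely_continuous_on_def by blast
  show "\<exists>\<delta>>0. \<forall>(n::nat) a b.
        (\<forall>k<n. a k \<le> b k \<and> {a k..b k} \<subseteq> S') \<and>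
        (\<forall>k<n. \<forall>l<n. k \<noteq> l \<longrightarrow> {a k<..<b k} \<inter> {a l<..<b l} = {}) \<and>
        (\<Sum>k<n. b k - a k) < \<delta>
        \<longrightarrow> (\<Sum>k<n. \<bar>f (b k) - f (a k)\<bar>) < \<epsilon>"
    using \<open>\<delta> > 0\<close> ac assms(2) by (meson order_trans)
qed

lemma absolutely_continuous_on_add:
  assumes "absolutely_continuous_on S f" "absolutely_continuous_on S g"
  shows "absolutely_continuous_on S (\<lambda>x. f x + g x)"
  unfolding absolutely_continuous_on_def
proof (intro allI impI)
  fix \<epsilon> :: real assume "\<epsilon> > 0"
  then have "\<epsilon> / 2 > 0" by simp
  obtain \<delta>1 where \<delta>1: "\<delta>1 > 0" and f: "\<forall>(I::nat set) l r. finite I \<and> (\<forall>i\<in>I. l i \<le> r i \<and> {l i..r i} \<subseteq> S) \<and>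
       (\<forall>i\<in>I. \<forall>j\<in>I. i \<noteq> j \<longrightarrow> {l i<..<r i} \<inter> {l j<..<r j} = {}) \<and>
       (\<Sum>i\<in>I. r i - l i) < \<delta>1 \<longrightarrow> (\<Sum>i\<in>I. \<bar>f (r i) - f (l i)\<bar>) < \<epsilon> / 2"
    by (rule absolutely_continuous_on_indexedE[OF assms(1) \<open>\<epsilon> / 2 > 0\<close>, where 'i = nat])
  obtain \<delta>2 where \<delta>2: "\<delta>2 > 0" and g: "\<forall>(I::nat set) l r. finite I \<and> (\<forall>i\<in>I. l i \<le> r i \<and> {l i..r i} \<subseteq> S) \<and>
       (\<forall>i\<in>I. \<forall>j\<in>I. i \<noteq> j \<longrightarrow> {l i<..<r i} \<inter> {l j<..<r j} = {}) \<and>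
       (\<Sum>i\<in>I. r i - l i) < \<delta>2 \<longrightarrow> (\<Sum>i\<in>I. \<bar>g (r i) - g (l i)\<bar>) < \<epsilon> / 2"
    by (rule absolutely_continuous_on_indexedE[OF assms(2) \<open>\<epsilon> / 2 > 0\<close>, where 'i = nat])
  show "\<exists>\<delta>>0. \<forall>(n::nat) a b.
        (\<forall>k<n. a k \<le> b k \<and> {a k..b k} \<subseteq> S) \<and>
        (\<forall>k<n. \<forall>l<n. k \<noteq> l \<longrightarrow> {a k<..<b k} \<inter> {a l<..<b l} = {}) \<and>
        (\<Sum>k<n. b k - a k) < \<delta>
        \<longrightarrow> (\<Sum>k<n. \<bar>(f (b k) + g (b k)) - (f (a k) + g (a k))\<bar>) < \<epsilon>"
  proof (intro exI[of _ "min \<delta>1 \<delta>2"] conjI allI impI)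
    fix n :: nat and a b :: "nat \<Rightarrow> real"
    assume *: "(\<forall>k<n. a k \<le> b k \<and> {a k..b k} \<subseteq> S) \<and>
        (\<forall>k<n. \<forall>l<n. k \<noteq> l \<longrightarrow> {a k<..<b k} \<inter> {a l<..<b l} = {}) \<and>
        (\<Sum>k<n. b k - a k) < min \<delta>1 \<delta>2"
    have "(\<Sum>k<n. \<bar>(f (b k) + g (b k)) - (f (a k) + g (a k))\<bar>)
        \<le> (\<Sum>k<n. \<bar>f (b k) - f (a k)\<bar> + \<bar>g (b k) - g (a k)\<bar>)"
      by (intro sum_mono) linarith
    moreover have "(\<Sum>k<n. \<bar>f (b k) - f (a k)\<bar>) < \<epsilon> / 2"
      by (rule f[rule_format]) (use * in auto)
    moreover have "(\<Sum>k<n. \<bar>g (b k) - g (a k)\<bar>) < \<epsilon> / 2"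
      by (rule g[rule_format]) (use * in auto)
    ultimately show "(\<Sum>k<n. \<bar>(f (b k) + g (b k)) - (f (a k) + g (a k))\<bar>) < \<epsilon>"
      by (simp add: sum.distrib)
  qed (use \<delta>1 \<delta>2 in auto)
qed

lemma absolutely_continuous_on_uminus:
  assumes "absolutely_continuous_on S f"
  shows "absolutely_continuous_on S (\<lambda>x. - f x)"
proof -
  have "\<bar>- x - - y\<bar> = \<bar>x - y\<bar>" for x y :: real by linarith
  then show ?thesis using assms unfolding absolutely_continuous_on_def by simp
qed

lemma lipschitz_on_imp_absolutely_continuous_on:
  fixes f :: "real \<Rightarrow> real"
  assumes "L-lipschitz_on S f"
  shows "absolutely_continuous_on S f"
  unfolding absolutely_continuous_on_def
proof (intro allI impI)
  fix \<epsilon> :: real assume "\<epsilon> > 0"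
  have L: "L \<ge> 0" using lipschitz_on_nonneg[OF assms] .
  show "\<exists>\<delta>>0. \<forall>(n::nat) a b.
        (\<forall>k<n. a k \<le> b k \<and> {a k..b k} \<subseteq> S) \<and>
        (\<forall>k<n. \<forall>l<n. k \<noteq> l \<longrightarrow> {a k<..<b k} \<inter> {a l<..<b l} = {}) \<and>
        (\<Sum>k<n. b k - a k) < \<delta>
        \<longrightarrow> (\<Sum>k<n. \<bar>f (b k) - f (a k)\<bar>) < \<epsilon>"
  proof (intro exI[of _ "\<epsilon> / (L + 1)"] conjI allI impI)
    show "\<epsilon> / (L + 1) > 0" using L \<open>\<epsilon> > 0\<close> by simp
    fix n :: nat and a b :: "nat \<Rightarrow> real"
    assume *: "(\<forall>k<n. a k \<le> b k \<and> {a k..b k} \<subseteq> S) \<and>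
        (\<forall>k<n. \<forall>l<n. k \<noteq> l \<longrightarrow> {a k<..<b k} \<inter> {a l<..<b l} = {}) \<and>
        (\<Sum>k<n. b k - a k) < \<epsilon> / (L + 1)"
    have "\<bar>f (b k) - f (a k)\<bar> \<le> (L + 1) * (b k - a k)" if "k < n" for k
    proof -
      have k: "a k \<le> b k" "a k \<in> S" "b k \<in> S" using * that by (auto simp: subset_iff)
      have "\<bar>f (b k) - f (a k)\<bar> \<le> L * (b k - a k)"
        using lipschitz_onD[OF assms k(3) k(2)] k(1) by (simp add: dist_real_def)
      also have "\<dots> \<le> (L + 1) * (b k - a k)" using k(1) by (intro mult_right_mono) auto
      finally show ?thesis .
    qed
    then have "(\<Sum>k<n. \<bar>f (b k) - f (a k)\<bar>) \<le> (L + 1) * (\<Sum>k<n. b k - a k)"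
      unfolding sum_distrib_left by (intro sum_mono) auto
    also have "\<dots> < \<epsilon>" using * L by (simp add: field_simps)
    finally show "(\<Sum>k<n. \<bar>f (b k) - f (a k)\<bar>) < \<epsilon>" .
  qed
qed

lemma absolutely_continuous_on_imp_continuous_on:
  assumes "absolutely_continuous_on {a..b} f"
  shows "continuous_on {a..b} f"
  unfolding continuous_on_iff
proof (intro ballI allI impI)
  fix x \<epsilon> :: real assume x: "x \<in> {a..b}" and \<epsilon>: "\<epsilon> > 0"
  obtain \<delta> where \<delta>: "\<delta> > 0" and f: "\<forall>(I::unit set) l r. finite I \<and> (\<forall>i\<in>I. l i \<le> r i \<and> {l i..r i} \<subseteq> {a..b}) \<and>
       (\<forall>i\<in>I. \<forall>j\<in>I. i \<noteq> j \<longrightarrow> {l i<..<r i} \<inter> {l j<..<r j} = {}) \<and>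
       (\<Sum>i\<in>I. r i - l i) < \<delta> \<longrightarrow> (\<Sum>i\<in>I. \<bar>f (r i) - f (l i)\<bar>) < \<epsilon>"
    by (rule absolutely_continuous_on_indexedE[OF assms \<epsilon>, where 'i = unit])
  have "dist (f y) (f x) < \<epsilon>" if "y \<in> {a..b}" "dist y x < \<delta>" for y
    using f[rule_format, of UNIV "\<lambda>_. x" "\<lambda>_. y"] f[rule_format, of UNIV "\<lambda>_. y" "\<lambda>_. x"] x that
    by (cases "x \<le> y") (auto simp: dist_real_def abs_minus_commute)
  with \<delta> show "\<exists>d>0. \<forall>x'\<in>{a..b}. dist x' x < d \<longrightarrow> dist (f x') (f x) < \<epsilon>"
    by blast
qed

section \<open>Fine covers and Vitali's theorem\<close>

text \<open>The points at which the intervals with property \<open>P\<close> form a Vitali cover. The point is required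
  to be interior to the covering intervals: this makes the set a countable intersection of open
  sets, hence measurable, for any \<open>P\<close> whatsoever.\<close>

definition finely_covered :: "(real \<Rightarrow> real \<Rightarrow> bool) \<Rightarrow> real set" where
  "finely_covered P = {x. \<forall>e>0. \<exists>u v. u < x \<and> x < v \<and> v - u < e \<and> P u v}"

lemma finely_covered_borel: "finely_covered P \<in> sets borel"
proof -
  have "finely_covered P =
      (\<Inter>n::nat. \<Union>(u, v)\<in>{(u, v). v - u < 1 / real (Suc n) \<and> P u v}. {u<..<v})"
    (is "_ = ?R")
  proof (intro set_eqI iffI)
    fix x assume "x \<in> finely_covered P"
    then have "\<exists>u v. u < x \<and> x < v \<and> v - u < 1 / real (Suc n) \<and> P u v" for n
      unfolding finely_covered_def by simp
    then show "x \<in> ?R" by fastforce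
  next
    fix x assume x: "x \<in> ?R"
    show "x \<in> finely_covered P"
      unfolding finely_covered_def
    proof (intro CollectI allI impI)
      fix e :: real assume "e > 0"
      then obtain n where n: "1 / real (Suc n) < e" using nat_approx_posE by blast
      have "x \<in> (\<Union>(u, v)\<in>{(u, v). v - u < 1 / real (Suc n) \<and> P u v}. {u<..<v})"
        using x by blast
      then obtain u v where "u < x" "x < v" "v - u < 1 / real (Suc n)" "P u v"
        by auto
      with n show "\<exists>u v. u < x \<and> x < v \<and> v - u < e \<and> P u v"
        by (meson less_trans)
    qed
  qed
  then show ?thesis
    by (simp only:) (intro sets.countable_INT'' borel_open open_UN, auto)
qed

lemma finely_covered_restrict_open:
  assumes "open G" "x \<in> G" "x \<in> finely_covered P"
  shows "x \<in> finely_covered (\<lambda>u v. P u v \<and> {u..v} \<subseteq> G)"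
  unfolding finely_covered_def
proof (intro CollectI allI impI)
  fix e :: real assume "e > 0"
  obtain r where r: "r > 0" "ball x r \<subseteq> G" using assms(1,2) openE by blast
  obtain u v where uv: "u < x" "x < v" "v - u < min e r" "P u v"
    using assms(3) \<open>e > 0\<close> r(1) unfolding finely_covered_def by (auto dest: spec[of _ "min e r"])
  have "{u..v} \<subseteq> ball x r" using uv by (auto simp: dist_real_def)
  with r(2) uv show "\<exists>u v. u < x \<and> x < v \<and> v - u < e \<and> P u v \<and> {u..v} \<subseteq> G"
    by (intro exI[of _ u] exI[of _ v]) auto
qed

text \<open>Vitali's theorem gives a countable disjoint subfamily covering almost all of \<open>S\<close>. Its members
  lie in the bounded set \<open>G\<close>, so finitely many of them already carry all but \<open>\<delta>\<close> of the measure, and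
  only finite families can be tested against absolute continuity.\<close>

lemma finite_vitali_intervals:
  assumes S: "S \<in> lmeasurable" "S \<subseteq> finely_covered P" and G: "open G" "bounded G" "S \<subseteq> G"
    and \<delta>: "\<delta> > 0"
  obtains \<D> where "finite \<D>" "pairwise disjnt \<D>" "\<Union>\<D> \<subseteq> G"
    "\<And>K. K \<in> \<D> \<Longrightarrow> \<exists>u v. u < v \<and> K = {u..v} \<and> P u v"
    "measure lebesgue (S - \<Union>\<D>) < \<delta>"
proof -
  define I where "I = {(u, v). u < v \<and> P u v \<and> {u..v} \<subseteq> G}"
  define c where "c = (\<lambda>(u, v). (u + v) / 2 :: real)"
  define r where "r = (\<lambda>(u, v). (v - u) / 2 :: real)"
  have cb: "cball (c i) (r i) = {fst i..snd i}" for i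
    by (cases i) (simp add: c_def r_def cball_eq_atLeastAtMost field_simps)
  obtain C where C: "countable C" "C \<subseteq> I"
     "pairwise (\<lambda>i j. disjnt (cball (c i) (r i)) (cball (c j) (r j))) C"
     "negligible (S - (\<Union>i\<in>C. cball (c i) (r i)))"
  proof (rule Vitali_covering_theorem_cballs[of I r S c])
    show "0 < r i" if "i \<in> I" for i using that by (auto simp: I_def r_def)
    fix x d :: real assume x: "x \<in> S" and d: "0 < d"
    then have "x \<in> finely_covered (\<lambda>u v. P u v \<and> {u..v} \<subseteq> G)"
      using finely_covered_restrict_open G S by blast
    then obtain u v where "u < x" "x < v" "v - u < d" "P u v \<and> {u..v} \<subseteq> G"
      using d unfolding finely_covered_def by blast
    then show "\<exists>i. i \<in> I \<and> x \<in> cball (c i) (r i) \<and> r i < d"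
      by (intro exI[of _ "(u, v)"]) (auto simp: I_def cb, simp add: r_def)
  qed
  define \<C> where "\<C> = (\<lambda>i. {fst i..snd i}) ` C"
  have neg: "negligible (S - \<Union>\<C>)" using C(4) by (simp add: cb \<C>_def)
  have Glm: "G \<in> lmeasurable" using G by (simp add: lmeasurable_open)
  have meas: "K \<in> lmeasurable" if "K \<in> \<C>" for K using that by (auto simp: \<C>_def)
  have CG: "\<Union>\<C> \<subseteq> G" using C(2) by (fastforce simp: \<C>_def I_def)
  have count: "countable \<C>" using C(1) by (simp add: \<C>_def)
  obtain \<D> where \<D>: "\<D> \<subseteq> \<C>" "finite \<D>"
    "measure lebesgue (\<Union>\<C>) - \<delta> < measure lebesgue (\<Union>\<D>)"
  proof (rule measure_countable_Union_approachable[OF count \<delta> meas])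
    show "measure lebesgue (\<Union>D') \<le> measure lebesgue G" if "D' \<subseteq> \<C>" "finite D'" for D'
    proof -
      have "\<Union>D' \<in> lmeasurable" using that meas by (intro fmeasurable.finite_Union) auto
      then show ?thesis using that CG Glm by (intro measure_mono_fmeasurable) auto
    qed
  qed auto
  have UC: "\<Union>\<C> \<in> lmeasurable"
    by (rule fmeasurableI2[OF Glm CG]) (use meas count in \<open>auto intro!: sets.countable_Union\<close>)
  have UD: "\<Union>\<D> \<in> lmeasurable"
    using \<D> meas by (intro fmeasurable.finite_Union) auto
  show ?thesis
  proof (rule that)
    show "finite \<D>" by fact
    have "pairwise disjnt \<C>"
      using C(3) unfolding \<C>_def cb pairwise_image by (auto simp: pairwise_def)
    then show "pairwise disjnt \<D>" using \<D>(1) by (rule pairwise_subset)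
    show "\<Union>\<D> \<subseteq> G" using CG \<D>(1) by blast
    show "\<exists>u v. u < v \<and> K = {u..v} \<and> P u v" if "K \<in> \<D>" for K
    proof -
      obtain i where "i \<in> I" "K = {fst i..snd i}"
        using \<open>K \<in> \<D>\<close> \<D>(1) C(2) unfolding \<C>_def by blast
      then show ?thesis by (auto simp: I_def)
    qed
    have "measure lebesgue (S - \<Union>\<D>) \<le> measure lebesgue ((S - \<Union>\<C>) \<union> (\<Union>\<C> - \<Union>\<D>))"
      using S(1) UC UD by (intro measure_mono_fmeasurable) (auto intro: fmeasurable.Un)
    also have "\<dots> \<le> measure lebesgue (S - \<Union>\<C>) + measure lebesgue (\<Union>\<C> - \<Union>\<D>)"
      using S(1) UC UD by (intro measure_Un_le) auto
    also have "\<dots> = measure lebesgue (\<Union>\<C>) - measure lebesgue (\<Union>\<D>)"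
      using neg UC UD \<D>(1)
      by (subst measurable_measure_Diff) (auto simp: negligible_imp_measure0)
    finally show "measure lebesgue (S - \<Union>\<D>) < \<delta>" using \<D>(3) by linarith
  qed
qed

lemma sum_increments_division:
  fixes f :: "real \<Rightarrow> real"
  assumes "c \<le> d" and q: "q division_of {c..d}"
  shows "(\<Sum>K\<in>q. f (Sup K) - f (Inf K)) = f d - f c"
proof -
  define p where "p = (\<lambda>K. (Inf K, K)) ` q"
  have *: "\<exists>u v. u \<le> v \<and> K = {u..v}" if "K \<in> q" for K
  proof -
    obtain u v where "K = cbox u v" "K \<noteq> {}" using division_ofD(3,4)[OF q \<open>K \<in> q\<close>] by blast
    then show ?thesis by (intro exI[of _ u] exI[of _ v]) auto
  qed
  have "p tagged_division_of {c..d}"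
  proof (rule tagged_division_ofI)
    show "finite p" using division_ofD(1)[OF q] by (simp add: p_def)
    show "\<Union>{K. \<exists>x. (x, K) \<in> p} = {c..d}"
    proof -
      have "{K. \<exists>x. (x, K) \<in> p} = q" by (auto simp: p_def image_iff)
      then show ?thesis using division_ofD(6)[OF q] by simp
    qed
    fix x K assume xK: "(x, K) \<in> p"
    then have K: "K \<in> q" and x: "x = Inf K" by (auto simp: p_def)
    obtain u v where "u \<le> v" "K = {u..v}" using *[OF K] by blast
    then show "x \<in> K" "\<exists>a b. K = cbox a b" using x by (auto intro: exI[of _ u] exI[of _ v])
    show "K \<subseteq> {c..d}" using division_ofD(2)[OF q K] .
    fix x' K' assume "(x', K') \<in> p" "(x, K) \<noteq> (x', K')"
    then show "interior K \<inter> interior K' = {}"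
      using xK division_ofD(5)[OF q] by (auto simp: p_def)
  qed
  then have "(\<Sum>(x, K)\<in>p. f (Sup K) - f (Inf K)) = f d - f c"
    by (rule additive_tagged_division_1[OF \<open>c \<le> d\<close>])
  then show ?thesis
    by (simp add: p_def sum.reindex inj_on_def)
qed

text \<open>If the intervals over which \<open>f\<close> does not decrease cover \<open>E\<close> finely, a decrease of \<open>f\<close> over \<open>[c,d]\<close>
  must take place on the gaps left by finitely many of them, whose total length is little more than
  the measure of \<open>[c,d]\<close> outside \<open>E\<close>. The gaps come from a division and may be degenerate, so they
  are separated only up to their end points.\<close>

lemma increment_ge_sum_over_gaps:
  fixes f :: "real \<Rightarrow> real"
  assumes "c < d" and E: "E \<in> lmeasurable"
    and cover: "E \<inter> {c<..<d} \<subseteq> finely_covered (\<lambda>u v. f u \<le> f v)" and \<delta>: "\<delta> > 0"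
  obtains R where "finite R" "\<forall>K\<in>R. \<exists>u v. u \<le> v \<and> K = {u..v} \<and> {u..v} \<subseteq> {c..d}"
    "\<forall>K\<in>R. \<forall>L\<in>R. K \<noteq> L \<longrightarrow> {Inf K<..<Sup K} \<inter> {Inf L<..<Sup L} = {}"
    "(\<Sum>K\<in>R. Sup K - Inf K) \<le> measure lebesgue ({c..d} - E) + \<delta>"
    "(\<Sum>K\<in>R. f (Sup K) - f (Inf K)) \<le> f d - f c"
proof -
  have cd: "{c<..<d} \<in> lmeasurable" "{c..d} \<in> lmeasurable" by auto
  have EI: "E \<inter> {c<..<d} \<in> lmeasurable" using E cd by (simp add: fmeasurable.Int)
  obtain J where J: "finite J" "pairwise disjnt J" "\<Union>J \<subseteq> {c<..<d}"
    "\<And>K. K \<in> J \<Longrightarrow> \<exists>u v. u < v \<and> K = {u..v} \<and> f u \<le> f v"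
    "measure lebesgue (E \<inter> {c<..<d} - \<Union>J) < \<delta>"
    by (rule finite_vitali_intervals[OF EI cover _ _ _ \<delta>, of "{c<..<d}"]) auto
  have "J division_of (\<Union>J)"
  proof (rule division_ofI)
    fix K assume "K \<in> J"
    with J(4) obtain u v where uv: "u < v" "K = {u..v}" by blast
    then show "K \<noteq> {}" "\<exists>a b. K = cbox a b" by (auto intro: exI[of _ u] exI[of _ v])
    show "K \<subseteq> \<Union>J" using \<open>K \<in> J\<close> by blast
    fix L assume "L \<in> J" "K \<noteq> L"
    then have "K \<inter> L = {}" using J(2) \<open>K \<in> J\<close> by (auto simp: pairwise_def disjnt_def)
    then show "interior K \<inter> interior L = {}" using interior_subset by blast
  qed (use J in auto)
  moreover have "\<Union>J \<subseteq> cbox c d" using J(3) by force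
  ultimately obtain q where q: "J \<subseteq> q" "q division_of {c..d}"
    by (metis partial_division_extend_interval cbox_interval)
  have qK: "\<exists>u v. u \<le> v \<and> K = {u..v} \<and> {u..v} \<subseteq> {c..d}" if "K \<in> q" for K
  proof -
    obtain u v where "K = cbox u v" "K \<noteq> {}" "K \<subseteq> {c..d}"
      using division_ofD(2-4)[OF q(2) \<open>K \<in> q\<close>] by blast
    then show ?thesis by (intro exI[of _ u] exI[of _ v]) auto
  qed
  have fin: "finite q" using division_ofD(1)[OF q(2)] .
  have split: "(\<Sum>K\<in>q - J. F (Sup K) - F (Inf K)) = F d - F c - (\<Sum>K\<in>J. F (Sup K) - F (Inf K))"
    for F :: "real \<Rightarrow> real"
    using sum_increments_division[OF less_imp_le[OF \<open>c < d\<close>] q(2), of F]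
      sum_diff[OF fin q(1), of "\<lambda>K. F (Sup K) - F (Inf K)"] by simp
  have Jlm: "K \<in> lmeasurable" if "K \<in> J" for K using J(4)[OF that] by auto
  have UJ: "\<Union>J \<in> lmeasurable" using J(1) Jlm by (intro fmeasurable.finite_Union) auto
  have XYZ: "{c..d} - E \<in> lmeasurable" "E \<inter> {c<..<d} - \<Union>J \<in> lmeasurable" "{c, d} \<in> lmeasurable"
    using cd E EI UJ by (auto intro: negligible_imp_measurable)
  show ?thesis
  proof (rule that[of "q - J"])
    show "finite (q - J)" using fin by simp
    show "\<forall>K\<in>q - J. \<exists>u v. u \<le> v \<and> K = {u..v} \<and> {u..v} \<subseteq> {c..d}"
      using qK by blast
    show "\<forall>K\<in>q - J. \<forall>L\<in>q - J. K \<noteq> L \<longrightarrow> {Inf K<..<Sup K} \<inter> {Inf L<..<Sup L} = {}"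
    proof (intro ballI impI)
      fix K L assume KL: "K \<in> q - J" "L \<in> q - J" "K \<noteq> L"
      have "interior K = {Inf K<..<Sup K}" if "K \<in> q" for K
        using qK[OF that] by (auto simp: interior_atLeastAtMost_real)
      moreover have "interior K \<inter> interior L = {}" using division_ofD(5)[OF q(2)] KL by blast
      ultimately show "{Inf K<..<Sup K} \<inter> {Inf L<..<Sup L} = {}" using KL by simp
    qed
    show "(\<Sum>K\<in>q - J. f (Sup K) - f (Inf K)) \<le> f d - f c"
    proof -
      have "0 \<le> (\<Sum>K\<in>J. f (Sup K) - f (Inf K))"
        using J(4) by (intro sum_nonneg) fastforce
      then show ?thesis using split[of f] by simp
    qed
    have "(\<Sum>K\<in>J. Sup K - Inf K) = (\<Sum>K\<in>J. measure lebesgue K)"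
      using J(4) by (intro sum.cong) fastforce+
    also have "\<dots> = measure lebesgue (\<Union>J)"
      using measure_Union'[OF J(1), of lebesgue] Jlm J(2) by simp
    finally have "(\<Sum>K\<in>q - J. Sup K - Inf K) = measure lebesgue {c..d} - measure lebesgue (\<Union>J)"
      using split[of "\<lambda>x. x"] \<open>c < d\<close> by simp
    also have "\<dots> = measure lebesgue ({c..d} - \<Union>J)"
      using J(3) UJ cd by (subst measurable_measure_Diff) (auto simp: subset_iff)
    also have "\<dots> \<le> measure lebesgue (({c..d} - E) \<union> ((E \<inter> {c<..<d} - \<Union>J) \<union> {c, d}))"
      using UJ cd by (intro measure_mono_fmeasurable fmeasurable.Un XYZ) auto
    also have "\<dots> \<le> measure lebesgue ({c..d} - E) + measure lebesgue ((E \<inter> {c<..<d} - \<Union>J) \<union> {c, d})"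
      by (intro measure_Un_le sets.Un fmeasurableD XYZ)
    also have "measure lebesgue ((E \<inter> {c<..<d} - \<Union>J) \<union> {c, d})
        \<le> measure lebesgue (E \<inter> {c<..<d} - \<Union>J) + measure lebesgue {c, d}"
      by (intro measure_Un_le fmeasurableD XYZ)
    also have "measure lebesgue {c, d} = 0"
      by (rule negligible_imp_measure0) simp
    finally show "(\<Sum>K\<in>q - J. Sup K - Inf K) \<le> measure lebesgue ({c..d} - E) + \<delta>"
      using J(5) by linarith
  qed
qed

lemma lmeasurable_interval_Int_borel:
  assumes "A \<in> sets borel"
  shows "{a<..<b::real} \<inter> A \<in> lmeasurable"
proof (rule bounded_set_imp_lmeasurable)
  show "bounded ({a<..<b} \<inter> A)"
    by (rule bounded_subset[OF bounded_closed_interval[of a b]]) auto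
  have "{a<..<b} \<inter> A \<in> sets lborel" using assms by simp
  then show "{a<..<b} \<inter> A \<in> sets lebesgue" by (rule sets_completionI_sets)
qed

lemma absolutely_continuous_on_cmult_ident: "absolutely_continuous_on S (\<lambda>x. c * x)"
proof (rule lipschitz_on_imp_absolutely_continuous_on)
  show "\<bar>c\<bar>-lipschitz_on S (\<lambda>x. c * x)"
    by (rule lipschitz_onI) (auto simp: dist_real_def simp flip: abs_mult right_diff_distrib)
qed

lemma sum_lengths_disjoint_intervals:
  assumes \<D>: "finite \<D>" "pairwise disjnt \<D>" "\<And>K. K \<in> \<D> \<Longrightarrow> \<exists>u v. u < v \<and> K = {u..v::real}"
    and E: "E \<in> lmeasurable"
  shows "measure lebesgue E \<le> measure lebesgue (E - \<Union>\<D>) + (\<Sum>K\<in>\<D>. Sup K - Inf K)"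
    and "(\<Sum>K\<in>\<D>. Sup K - Inf K) = measure lebesgue (\<Union>\<D>)"
    and "\<Union>\<D> \<in> lmeasurable"
proof -
  have lm: "K \<in> lmeasurable" if "K \<in> \<D>" for K using \<D>(3)[OF that] by auto
  show U: "\<Union>\<D> \<in> lmeasurable" using \<D>(1) lm by (intro fmeasurable.finite_Union) auto
  have "(\<Sum>K\<in>\<D>. Sup K - Inf K) = (\<Sum>K\<in>\<D>. measure lebesgue K)"
    using \<D>(3) by (intro sum.cong) fastforce+
  also have "\<dots> = measure lebesgue (\<Union>\<D>)"
    using measure_Union'[OF \<D>(1), of lebesgue] lm \<D>(2) by simp
  finally show *: "(\<Sum>K\<in>\<D>. Sup K - Inf K) = measure lebesgue (\<Union>\<D>)" .
  have "measure lebesgue E \<le> measure lebesgue ((E - \<Union>\<D>) \<union> \<Union>\<D>)"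
    using E U by (intro measure_mono_fmeasurable) auto
  also have "\<dots> \<le> measure lebesgue (E - \<Union>\<D>) + measure lebesgue (\<Union>\<D>)"
    using E U by (intro measure_Un_le) auto
  finally show "measure lebesgue E \<le> measure lebesgue (E - \<Union>\<D>) + (\<Sum>K\<in>\<D>. Sup K - Inf K)"
    by (simp only: *)
qed

text \<open>Subtracting \<open>q x\<close> turns the slopes into a decrease at rate \<open>q - p\<close> over the intervals of the first
  kind, and no decrease over those of the second kind. The latter nearly fill the former, so the
  decrease would have to happen on gaps of arbitrarily small total length.\<close>

lemma negligible_two_slopes:
  assumes ac: "absolutely_continuous_on {a..b} f" and "p < q"
  shows "negligible ({a<..<b} \<inter> (finely_covered (\<lambda>u v. f v - f u < p * (v - u)) \<inter>
           finely_covered (\<lambda>u v. q * (v - u) < f v - f u)))"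
    (is "negligible ?E")
proof (rule ccontr)
  define E where "E = ?E"
  have E: "E \<in> lmeasurable"
    unfolding E_def by (intro lmeasurable_interval_Int_borel sets.Int finely_covered_borel)
  define m where "m = measure lebesgue E"
  assume "\<not> negligible ?E"
  then have m: "m > 0"
    using E unfolding m_def E_def[symmetric] negligible_iff_measure
    by (simp add: zero_less_measure_iff)
  define F where "F x = f x - q * x" for x
  have acF: "absolutely_continuous_on {a..b} F"
    using absolutely_continuous_on_add[OF ac absolutely_continuous_on_cmult_ident[of _ "- q"]]
    by (simp add: F_def[abs_def])
  \<comment> \<open>a lower bound for the decrease of \<open>F\<close> over disjoint intervals of slope below \<open>p\<close> covering half of \<open>E\<close>\<close>
  define \<epsilon> where "\<epsilon> = (q - p) * (m / 2)"
  have "\<epsilon> > 0" using m \<open>p < q\<close> by (simp add: \<epsilon>_def)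
  obtain \<delta> where \<delta>: "\<delta> > 0" and small: "\<forall>(I::(real set \<times> real set) set) l r. finite I \<and>
       (\<forall>i\<in>I. l i \<le> r i \<and> {l i..r i} \<subseteq> {a..b}) \<and>
       (\<forall>i\<in>I. \<forall>j\<in>I. i \<noteq> j \<longrightarrow> {l i<..<r i} \<inter> {l j<..<r j} = {}) \<and>
       (\<Sum>i\<in>I. r i - l i) < \<delta> \<longrightarrow> (\<Sum>i\<in>I. \<bar>F (r i) - F (l i)\<bar>) < \<epsilon>"
    by (rule absolutely_continuous_on_indexedE[OF acF \<open>\<epsilon> > 0\<close>])
  obtain G0 where G0: "open G0" "E \<subseteq> G0" "G0 - E \<in> lmeasurable"
      "emeasure lebesgue (G0 - E) < ennreal (\<delta> / 2)"
    using sets_lebesgue_outer_open[of E "\<delta> / 2"] E \<delta> by (metis fmeasurableD half_gt_zero)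
  have G0m: "measure lebesgue (G0 - E) < \<delta> / 2"
    using G0(3,4) \<delta> by (simp add: emeasure_eq_measure2 ennreal_less_iff)
  define G where "G = G0 \<inter> {a<..<b}"
  have G: "open G" "bounded G" "E \<subseteq> G"
    using G0 by (auto simp: G_def E_def bounded_Int)
  have "E \<subseteq> finely_covered (\<lambda>u v. f v - f u < p * (v - u))" by (auto simp: E_def)
  from finite_vitali_intervals[OF E this G, of "m / 2"] m
  obtain \<D> where \<D>: "finite \<D>" "pairwise disjnt \<D>" "\<Union>\<D> \<subseteq> G"
    "\<And>K. K \<in> \<D> \<Longrightarrow> \<exists>u v. u < v \<and> K = {u..v} \<and> f v - f u < p * (v - u)"
    "measure lebesgue (E - \<Union>\<D>) < m / 2"
    by auto
  have \<D>': "\<exists>u v. u < v \<and> K = {u..v}" if "K \<in> \<D>" for K using \<D>(4)[OF that] by blast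
  have len: "m / 2 \<le> (\<Sum>K\<in>\<D>. Sup K - Inf K)"
    using sum_lengths_disjoint_intervals(1)[OF \<D>(1,2) \<D>' E] \<D>(5) m_def by linarith
  \<comment> \<open>the slack allowed in each interval of \<open>\<D>\<close>; it adds up to less than \<open>\<delta> / 2\<close>\<close>
  define \<eta> where "\<eta> = \<delta> / (2 * (real (card \<D>) + 1))"
  have \<eta>: "\<eta> > 0" using \<delta> by (simp add: \<eta>_def)
  define gaps where "gaps K R \<longleftrightarrow> finite R \<and> (\<forall>L\<in>R. \<exists>u v. u \<le> v \<and> L = {u..v} \<and> {u..v} \<subseteq> K) \<and>
      (\<forall>L\<in>R. \<forall>M\<in>R. L \<noteq> M \<longrightarrow> {Inf L<..<Sup L} \<inter> {Inf M<..<Sup M} = {}) \<and>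
      (\<Sum>L\<in>R. Sup L - Inf L) \<le> measure lebesgue (K - E) + \<eta> \<and>
      (\<Sum>L\<in>R. F (Sup L) - F (Inf L)) \<le> F (Sup K) - F (Inf K)" for K R
  have "\<exists>R. gaps K R" if K: "K \<in> \<D>" for K
  proof -
    obtain c d where cd: "c < d" "K = {c..d}" using \<D>'[OF K] by blast
    have "E \<inter> {c<..<d} \<subseteq> finely_covered (\<lambda>u v. F u \<le> F v)"
    proof
      fix x assume "x \<in> E \<inter> {c<..<d}"
      then have *: "x \<in> finely_covered (\<lambda>u v. q * (v - u) < f v - f u)" by (auto simp: E_def)
      show "x \<in> finely_covered (\<lambda>u v. F u \<le> F v)"
        unfolding finely_covered_def
      proof (intro CollectI allI impI)
        fix e :: real assume "e > 0"
        with * obtain u v where "u < x" "x < v" "v - u < e" "q * (v - u) < f v - f u"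
          unfolding finely_covered_def by blast
        then show "\<exists>u v. u < x \<and> x < v \<and> v - u < e \<and> F u \<le> F v"
          by (intro exI[of _ u] exI[of _ v]) (auto simp: F_def algebra_simps)
      qed
    qed
    then obtain R where
      "finite R" "\<forall>K\<in>R. \<exists>u v. u \<le> v \<and> K = {u..v} \<and> {u..v} \<subseteq> {c..d}"
      "\<forall>K\<in>R. \<forall>L\<in>R. K \<noteq> L \<longrightarrow> {Inf K<..<Sup K} \<inter> {Inf L<..<Sup L} = {}"
      "(\<Sum>K\<in>R. Sup K - Inf K) \<le> measure lebesgue ({c..d} - E) + \<eta>"
      "(\<Sum>K\<in>R. F (Sup K) - F (Inf K)) \<le> F d - F c"
      by (rule increment_ge_sum_over_gaps[OF cd(1) E _ \<eta>])
    with cd show ?thesis unfolding gaps_def by (intro exI[of _ R]) auto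
  qed
  then obtain R where gaps: "\<And>K. K \<in> \<D> \<Longrightarrow> gaps K (R K)" by metis
  note R1 = gaps[unfolded gaps_def, THEN conjunct1]
  note R2 = gaps[unfolded gaps_def, THEN conjunct2, THEN conjunct1, THEN bspec]
  note R3 = gaps[unfolded gaps_def, THEN conjunct2, THEN conjunct2, THEN conjunct1]
  note R4 = gaps[unfolded gaps_def, THEN conjunct2, THEN conjunct2, THEN conjunct2, THEN conjunct1]
  note R5 = gaps[unfolded gaps_def, THEN conjunct2, THEN conjunct2, THEN conjunct2, THEN conjunct2]
  \<comment> \<open>Indexing by pairs spares a proof that the gap families of different intervals are disjoint as
    sets; a degenerate interval might belong to two of them.\<close>
  define I where "I = Sigma \<D> R"
  have "(\<Sum>i\<in>I. \<bar>F (Sup (snd i)) - F (Inf (snd i))\<bar>) < \<epsilon>"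
  proof (rule small[rule_format], intro conjI ballI impI)
    show "finite I" unfolding I_def using \<D>(1) R1 by auto
    fix i assume "i \<in> I"
    then obtain K L where i: "i = (K, L)" "K \<in> \<D>" "L \<in> R K" by (auto simp: I_def)
    obtain u v where uv: "u \<le> v" "L = {u..v}" "{u..v} \<subseteq> K" using R2[OF i(2,3)] by blast
    then show "Inf (snd i) \<le> Sup (snd i)" using i by simp
    have "K \<subseteq> {a..b}" using i(2) \<D>(3) by (auto simp: G_def subset_iff)
    then have "{u..v} \<subseteq> {a..b}" using uv(3) by blast
    then show "{Inf (snd i)..Sup (snd i)} \<subseteq> {a..b}" using i uv(1,2) by simp
    fix j assume "j \<in> I" "i \<noteq> j"
    then obtain K' L' where j: "j = (K', L')" "K' \<in> \<D>" "L' \<in> R K'" by (auto simp: I_def)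
    obtain u' v' where uv': "u' \<le> v'" "L' = {u'..v'}" "{u'..v'} \<subseteq> K'" using R2[OF j(2,3)] by blast
    show "{Inf (snd i)<..<Sup (snd i)} \<inter> {Inf (snd j)<..<Sup (snd j)} = {}"
    proof (cases "K = K'")
      case True
      then show ?thesis using R3[OF i(2)] i j \<open>i \<noteq> j\<close> by simp
    next
      case False
      then have "K \<inter> K' = {}" using \<D>(2) i(2) j(2) by (auto simp: pairwise_def disjnt_def)
      moreover have "{u<..<v} \<subseteq> K" "{u'<..<v'} \<subseteq> K'" using uv(3) uv'(3) by (auto simp: subset_iff)
      ultimately have "{u<..<v} \<inter> {u'<..<v'} = {}" by blast
      then show ?thesis using i(1) j(1) uv(1,2) uv'(1,2) by simp
    qed
  next
    have KE: "K - E \<in> lmeasurable" if "K \<in> \<D>" for K using \<D>'[OF that] E by auto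
    have "(\<Sum>i\<in>I. Sup (snd i) - Inf (snd i)) = (\<Sum>K\<in>\<D>. \<Sum>L\<in>R K. Sup L - Inf L)"
      unfolding I_def using \<D>(1) R1 by (subst sum.Sigma) (auto simp: case_prod_beta)
    also have "\<dots> \<le> (\<Sum>K\<in>\<D>. measure lebesgue (K - E) + \<eta>)" using R4 by (rule sum_mono)
    also have "\<dots> = (\<Sum>K\<in>\<D>. measure lebesgue (K - E)) + real (card \<D>) * \<eta>"
      by (simp add: sum.distrib)
    also have "(\<Sum>K\<in>\<D>. measure lebesgue (K - E)) = measure lebesgue (\<Union>K\<in>\<D>. K - E)"
      using \<D>(2) KE by (intro measure_UNION'[symmetric] \<D>(1)) (auto simp: pairwise_def disjnt_def)
    also have "\<dots> \<le> measure lebesgue (G0 - E)"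
    proof (rule measure_mono_fmeasurable[OF _ _ G0(3)])
      show "(\<Union>K\<in>\<D>. K - E) \<subseteq> G0 - E" using \<D>(3) by (auto simp: G_def)
      show "(\<Union>K\<in>\<D>. K - E) \<in> sets lebesgue"
        using \<D>(1) KE by (intro sets.finite_UN) auto
    qed
    also have "measure lebesgue (G0 - E) + real (card \<D>) * \<eta> < \<delta> / 2 + \<delta> / 2"
    proof (rule add_less_le_mono[OF G0m])
      show "real (card \<D>) * \<eta> \<le> \<delta> / 2" using \<delta> by (simp add: \<eta>_def field_simps)
    qed
    finally show "(\<Sum>i\<in>I. Sup (snd i) - Inf (snd i)) < \<delta>" by simp
  qed
  then have "- \<epsilon> < (\<Sum>i\<in>I. F (Sup (snd i)) - F (Inf (snd i)))"
    using sum_abs[of "\<lambda>i. F (Sup (snd i)) - F (Inf (snd i))" I] by linarith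
  also have "\<dots> = (\<Sum>K\<in>\<D>. \<Sum>L\<in>R K. F (Sup L) - F (Inf L))"
    unfolding I_def using \<D>(1) R1 by (subst sum.Sigma) (auto simp: case_prod_beta)
  also have "\<dots> \<le> (\<Sum>K\<in>\<D>. F (Sup K) - F (Inf K))" using R5 by (rule sum_mono)
  also have "\<dots> \<le> (\<Sum>K\<in>\<D>. (p - q) * (Sup K - Inf K))"
  proof (rule sum_mono)
    fix K assume "K \<in> \<D>"
    from \<D>(4)[OF this] show "F (Sup K) - F (Inf K) \<le> (p - q) * (Sup K - Inf K)"
      by (auto simp: F_def algebra_simps)
  qed
  also have "\<dots> = (p - q) * (\<Sum>K\<in>\<D>. Sup K - Inf K)" by (simp add: sum_distrib_left)
  also have "\<dots> \<le> (p - q) * (m / 2)" using len \<open>p < q\<close> by (intro mult_left_mono_neg) auto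
  finally show False by (simp add: \<epsilon>_def left_diff_distrib diff_divide_distrib)
qed

lemma not_finely_covered_iff:
  "x \<notin> finely_covered P \<longleftrightarrow> (\<exists>e>0. \<forall>u v. u < x \<and> x < v \<and> v - u < e \<longrightarrow> \<not> P u v)"
proof -
  have "(\<not> (\<exists>u v. u < x \<and> x < v \<and> v - u < e \<and> P u v)) \<longleftrightarrow>
      (\<forall>u v. u < x \<and> x < v \<and> v - u < e \<longrightarrow> \<not> P u v)" for e
    by blast
  then show ?thesis unfolding finely_covered_def mem_Collect_eq not_all not_imp by simp
qed

section \<open>Monotonicity from the sign of the derivative\<close>

text \<open>Intervals of slope below \<open>- n\<close> covering a set of measure \<open>m\<close> would force a variation of order
  \<open>n m\<close>. Absolute continuity bounds the variation by 1 only over families of total length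
  below \<open>\<delta>\<close>, so the argument is carried out on short intervals; negligibility is a local property.\<close>

lemma negligible_slope_minus_infinity:
  assumes ac: "absolutely_continuous_on {a..b} f"
  shows "negligible ({a<..<b} \<inter> (\<Inter>n::nat. finely_covered (\<lambda>u v. f v - f u < - real n * (v - u))))"
    (is "negligible ?E")
proof -
  obtain \<delta> where \<delta>: "\<delta> > 0" and small: "\<forall>(I::real set set) l r. finite I \<and>
       (\<forall>i\<in>I. l i \<le> r i \<and> {l i..r i} \<subseteq> {a..b}) \<and>
       (\<forall>i\<in>I. \<forall>j\<in>I. i \<noteq> j \<longrightarrow> {l i<..<r i} \<inter> {l j<..<r j} = {}) \<and>
       (\<Sum>i\<in>I. r i - l i) < \<delta> \<longrightarrow> (\<Sum>i\<in>I. \<bar>f (r i) - f (l i)\<bar>) < 1"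
    by (rule absolutely_continuous_on_indexedE[OF ac zero_less_one])
  have *: "negligible ({c<..<d} \<inter> ?E)" if cd: "c < d" "d - c < \<delta>" for c d
  proof (rule ccontr)
    define E where "E = {c<..<d} \<inter> ?E"
    define G where "G = {c<..<d} \<inter> {a<..<b}"
    have "?E \<in> sets borel"
      by (intro sets.Int sets.countable_INT'' finely_covered_borel) auto
    then have E: "E \<in> lmeasurable"
      unfolding E_def by (rule lmeasurable_interval_Int_borel)
    define m where "m = measure lebesgue E"
    assume "\<not> negligible ({c<..<d} \<inter> ?E)"
    then have m: "m > 0"
      using E unfolding m_def E_def[symmetric] negligible_iff_measure
      by (simp add: zero_less_measure_iff)
    obtain n :: nat where n: "2 / m < real n" using reals_Archimedean2 by blast
    have G: "open G" "bounded G" "E \<subseteq> G"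
      by (auto simp: G_def E_def bounded_Int)
    have "E \<subseteq> finely_covered (\<lambda>u v. f v - f u < - real n * (v - u))" by (auto simp: E_def)
    from finite_vitali_intervals[OF E this G, of "m / 2"] m
    obtain \<D> where \<D>: "finite \<D>" "pairwise disjnt \<D>" "\<Union>\<D> \<subseteq> G"
      "\<And>K. K \<in> \<D> \<Longrightarrow> \<exists>u v. u < v \<and> K = {u..v} \<and> f v - f u < - real n * (v - u)"
      "measure lebesgue (E - \<Union>\<D>) < m / 2"
      by auto
    have \<D>': "\<exists>u v. u < v \<and> K = {u..v}" if "K \<in> \<D>" for K using \<D>(4)[OF that] by blast
    have lengths: "(\<Sum>K\<in>\<D>. Sup K - Inf K) = measure lebesgue (\<Union>\<D>)" "\<Union>\<D> \<in> lmeasurable"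
      by (rule sum_lengths_disjoint_intervals(2,3)[OF \<D>(1,2) \<D>' E], assumption)+
    have len: "m / 2 \<le> (\<Sum>K\<in>\<D>. Sup K - Inf K)"
      using sum_lengths_disjoint_intervals(1)[OF \<D>(1,2) \<D>' E] \<D>(5) m_def by linarith
    have "(\<Sum>K\<in>\<D>. \<bar>f (Sup K) - f (Inf K)\<bar>) < 1"
    proof (rule small[rule_format], intro conjI ballI impI)
      show "finite \<D>" by fact
      have "(\<Sum>K\<in>\<D>. Sup K - Inf K) \<le> measure lebesgue {c<..<d}"
        unfolding lengths(1) using \<D>(3) lengths(2)
        by (intro measure_mono_fmeasurable) (auto simp: G_def)
      also have "\<dots> < \<delta>" using cd by simp
      finally show "(\<Sum>K\<in>\<D>. Sup K - Inf K) < \<delta>" .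
      fix K assume K: "K \<in> \<D>"
      obtain u v where uv: "u < v" "K = {u..v}" using \<D>'[OF K] by blast
      then show "Inf K \<le> Sup K" by simp
      have "K \<subseteq> {a..b}" using K \<D>(3) by (auto simp: G_def subset_iff)
      then show "{Inf K..Sup K} \<subseteq> {a..b}" using uv by simp
      fix L assume L: "L \<in> \<D>" "K \<noteq> L"
      obtain u' v' where uv': "u' < v'" "L = {u'..v'}" using \<D>'[OF L(1)] by blast
      have "K \<inter> L = {}" using \<D>(2) K L by (auto simp: pairwise_def disjnt_def)
      moreover have "{u<..<v} \<subseteq> K" "{u'<..<v'} \<subseteq> L" using uv uv' by (auto simp: subset_iff)
      ultimately have "{u<..<v} \<inter> {u'<..<v'} = {}" by blast
      then show "{Inf K<..<Sup K} \<inter> {Inf L<..<Sup L} = {}" using uv uv' by simp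
    qed
    moreover have "(\<Sum>K\<in>\<D>. real n * (Sup K - Inf K)) \<le> (\<Sum>K\<in>\<D>. \<bar>f (Sup K) - f (Inf K)\<bar>)"
    proof (rule sum_mono)
      fix K assume "K \<in> \<D>"
      from \<D>(4)[OF this] show "real n * (Sup K - Inf K) \<le> \<bar>f (Sup K) - f (Inf K)\<bar>" by auto
    qed
    moreover have "real n * (m / 2) \<le> (\<Sum>K\<in>\<D>. real n * (Sup K - Inf K))"
      unfolding sum_distrib_left[symmetric] using len by (intro mult_left_mono) auto
    moreover have "1 < real n * (m / 2)" using n m by (simp add: field_simps)
    ultimately show False by linarith
  qed
  show ?thesis
  proof (rule locally_negligible_alt[THEN iffD2], rule ballI)
    fix x assume x: "x \<in> ?E"
    let ?B = "{x - \<delta> / 3<..<x + \<delta> / 3}"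
    have "negligible (?B \<inter> ?E)" using \<delta> by (intro *) auto
    moreover have "openin (top_of_set ?E) (?B \<inter> ?E)" by (auto simp: openin_open)
    moreover have "x \<in> ?B \<inter> ?E" using x \<delta> by auto
    ultimately show "\<exists>U. openin (top_of_set ?E) U \<and> x \<in> U \<and> negligible U" by blast
  qed
qed

text \<open>Difference quotients at \<open>x\<close> are limits of slopes over intervals containing \<open>x\<close> in their
  interior, by continuity.\<close>

lemma has_real_derivative_if_slopes_converge:
  fixes f :: "real \<Rightarrow> real"
  assumes cont: "isCont f x"
    and slopes: "\<And>\<eta>. \<eta> > 0 \<Longrightarrow> \<exists>e>0. \<forall>u v. u < x \<and> x < v \<and> v - u < e \<longrightarrow>
      \<bar>f v - f u - L * (v - u)\<bar> \<le> \<eta> * (v - u)"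
  shows "(f has_real_derivative L) (at x)"
  unfolding has_field_derivative_def has_derivative_at_alt
proof (intro conjI allI impI)
  show "bounded_linear ((*) L)" by (rule bounded_linear_mult_right)
  fix \<eta> :: real assume "\<eta> > 0"
  then obtain e where e: "e > 0" and sl: "\<And>u v. u < x \<Longrightarrow> x < v \<Longrightarrow> v - u < e \<Longrightarrow>
      \<bar>f v - f u - L * (v - u)\<bar> \<le> \<eta> * (v - u)"
    using slopes by blast
  have fx: "(f \<longlongrightarrow> f x) (at x within S)" for S
    using cont continuous_at_imp_continuous_at_within continuous_within by blast
  show "\<exists>d>0. \<forall>y. norm (y - x) < d \<longrightarrow> norm (f y - f x - L * (y - x)) \<le> \<eta> * norm (y - x)"
  proof (intro exI[of _ "e / 2"] conjI allI impI)
    show "e / 2 > 0" using e by simp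
    fix y assume y: "norm (y - x) < e / 2"
    consider "y = x" | "x < y" | "y < x" by linarith
    then show "norm (f y - f x - L * (y - x)) \<le> \<eta> * norm (y - x)"
    proof cases
      case 1 then show ?thesis by simp
    next
      case 2
      have "\<bar>f y - f x - L * (y - x)\<bar> \<le> \<eta> * (y - x)"
      proof (rule tendsto_le[of "at_left x"])
        show "((\<lambda>u. \<eta> * (y - u)) \<longlongrightarrow> \<eta> * (y - x)) (at_left x)" by (intro tendsto_intros)
        show "((\<lambda>u. \<bar>f y - f u - L * (y - u)\<bar>) \<longlongrightarrow> \<bar>f y - f x - L * (y - x)\<bar>) (at_left x)"
          by (intro tendsto_intros fx)
        show "\<forall>\<^sub>F u in at_left x. \<bar>f y - f u - L * (y - u)\<bar> \<le> \<eta> * (y - u)"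
          unfolding eventually_at_left_field
          using y 2 e by (intro exI[of _ "x - e / 2"]) (auto intro!: sl simp: real_norm_def)
      qed simp
      then show ?thesis using 2 by simp
    next
      case 3
      have "\<bar>f x - f y - L * (x - y)\<bar> \<le> \<eta> * (x - y)"
      proof (rule tendsto_le[of "at_right x"])
        show "((\<lambda>v. \<eta> * (v - y)) \<longlongrightarrow> \<eta> * (x - y)) (at_right x)" by (intro tendsto_intros)
        show "((\<lambda>v. \<bar>f v - f y - L * (v - y)\<bar>) \<longlongrightarrow> \<bar>f x - f y - L * (x - y)\<bar>) (at_right x)"
          by (intro tendsto_intros fx)
        show "\<forall>\<^sub>F v in at_right x. \<bar>f v - f y - L * (v - y)\<bar> \<le> \<eta> * (v - y)"
          unfolding eventually_at_right_field
          using y 3 e by (intro exI[of _ "x + e / 2"]) (auto intro!: sl simp: real_norm_def)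
      qed simp
      moreover have "f y - f x - L * (y - x) = - (f x - f y - L * (x - y))" by (simp add: algebra_simps)
      ultimately show ?thesis using 3 by (simp only: real_norm_def abs_minus_cancel) simp
    qed
  qed
qed

text \<open>Outside the null sets of the previous lemmas the slopes around a point have a limit in
  \<open>(-\<infinity>, \<infinity>]\<close>. A finite limit is a derivative, hence nonnegative. So every such point
  has short surrounding intervals of slope at least \<open>- c\<close>, for any \<open>c > 0\<close>, and
  \<open>increment_ge_sum_over_gaps\<close> applies to \<open>f + c x\<close>.\<close>

lemma absolutely_continuous_nonneg_derivative_imp_le:
  assumes ac: "absolutely_continuous_on {a..b} f" and "a \<le> b"
    and der: "\<And>x D. a < x \<Longrightarrow> x < b \<Longrightarrow> (f has_real_derivative D) (at x) \<Longrightarrow> 0 \<le> D"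
  shows "f a \<le> f b"
proof (rule ccontr)
  assume neg: "\<not> ?thesis"
  define \<kappa> where "\<kappa> = f a - f b"
  have \<kappa>: "\<kappa> > 0" using neg by (simp add: \<kappa>_def)
  have ab: "a < b" using \<open>a \<le> b\<close> \<kappa> by (auto simp: \<kappa>_def less_le)
  \<comment> \<open>with this slope \<open>f + c x\<close> still decreases by \<open>\<kappa> / 2\<close> over \<open>[a,b]\<close>\<close>
  define c where "c = \<kappa> / (2 * (b - a))"
  have c: "c > 0" using \<kappa> ab by (simp add: c_def)
  define F where "F x = f x + c * x" for x
  have acF: "absolutely_continuous_on {a..b} F"
    using absolutely_continuous_on_add[OF ac absolutely_continuous_on_cmult_ident[of _ c]]
    by (simp add: F_def[abs_def])
  define Npq where "Npq = (\<lambda>(p, q). {a<..<b} \<inter> (finely_covered (\<lambda>u v. f v - f u < p * (v - u)) \<inter>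
           finely_covered (\<lambda>u v. q * (v - u) < f v - f u)))"
  define Ninf where "Ninf = {a<..<b} \<inter> (\<Inter>n::nat. finely_covered (\<lambda>u v. f v - f u < - real n * (v - u)))"
  define N where "N = (\<Union>i\<in>{(p, q). p \<in> \<rat> \<and> q \<in> \<rat> \<and> p < q}. Npq i) \<union> Ninf"
  have "negligible (\<Union>i\<in>{(p, q). p \<in> \<rat> \<and> q \<in> \<rat> \<and> p < q}. Npq i)"
  proof (rule negligible_countable_Union)
    have "{(p, q). p \<in> \<rat> \<and> q \<in> \<rat> \<and> p < (q::real)} \<subseteq> \<rat> \<times> \<rat>" by auto
    moreover have "countable (\<rat> \<times> (\<rat>::real set))" by (intro countable_SIGMA countable_rat)
    ultimately show "countable (Npq ` {(p, q). p \<in> \<rat> \<and> q \<in> \<rat> \<and> p < q})"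
      using countable_subset by blast
  qed (auto simp: Npq_def intro: negligible_two_slopes[OF ac])
  then have N: "negligible N"
    unfolding N_def Ninf_def by (intro negligible_Un negligible_slope_minus_infinity[OF ac])
  define E where "E = {a<..<b} - N"
  have E: "E \<in> lmeasurable"
    unfolding E_def using negligible_imp_measurable[OF N] by (intro fmeasurable.Diff) auto
  have "E \<inter> {a<..<b} \<subseteq> finely_covered (\<lambda>u v. F u \<le> F v)"
  proof
    fix x assume "x \<in> E \<inter> {a<..<b}"
    then have x: "a < x" "x < b" "x \<notin> N" by (auto simp: E_def)
    show "x \<in> finely_covered (\<lambda>u v. F u \<le> F v)"
    proof (rule ccontr)
      assume "\<not> ?thesis"
      then obtain e0 where e0: "e0 > 0" "\<And>u v. u < x \<Longrightarrow> x < v \<Longrightarrow> v - u < e0 \<Longrightarrow> F v < F u"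
        unfolding not_finely_covered_iff not_le by blast
      \<comment> \<open>the supremum of \<open>A\<close> is the lower limit of the slopes around \<open>x\<close>\<close>
      define A where "A = {p. \<exists>e>0. \<forall>u v. u < x \<and> x < v \<and> v - u < e \<longrightarrow> p * (v - u) \<le> f v - f u}"
      from x have "x \<notin> Ninf" by (auto simp: N_def)
      then obtain n :: nat where "x \<notin> finely_covered (\<lambda>u v. f v - f u < - real n * (v - u))"
        using x by (auto simp: Ninf_def)
      then have "- real n \<in> A"
        by (simp add: A_def not_finely_covered_iff not_less)
      then have ne: "A \<noteq> {}" by blast
      have upper: "p \<le> - c" if p: "p \<in> A" for p
      proof -
        obtain e where e: "e > 0" "\<And>u v. u < x \<Longrightarrow> x < v \<Longrightarrow> v - u < e \<Longrightarrow> p * (v - u) \<le> f v - f u"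
          using p unfolding A_def by blast
        define h where "h = min e e0 / 3"
        have h: "h > 0" "2 * h < e" "2 * h < e0" using e(1) e0(1) by (auto simp: h_def min_def)
        have "p * (2 * h) \<le> f (x + h) - f (x - h)" using e(2)[of "x - h" "x + h"] h by simp
        moreover have "F (x + h) < F (x - h)" using e0(2)[of "x - h" "x + h"] h by simp
        ultimately have "p * (2 * h) < - c * (2 * h)" by (simp add: F_def algebra_simps)
        then have "p < - c" using h(1) mult_less_cancel_right_pos[of "2 * h" p "- c"] by linarith
        then show ?thesis by simp
      qed
      then have bdd: "bdd_above A" by (auto simp: bdd_above_def)
      define L where "L = Sup A"
      have L: "L \<le> - c" unfolding L_def using upper by (intro cSup_least ne)
      have "(f has_real_derivative L) (at x)"
      proof (rule has_real_derivative_if_slopes_converge)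
        show "isCont f x"
          using absolutely_continuous_on_imp_continuous_on[OF ac] x
          by (intro continuous_on_interior[of "{a..b}"]) auto
        fix \<eta> :: real assume "\<eta> > 0"
        then have "L - \<eta> < Sup A" by (simp add: L_def)
        then obtain p where p: "p \<in> A" "L - \<eta> < p" using less_cSupE ne by blast
        then obtain e1 where e1: "e1 > 0"
            "\<And>u v. u < x \<Longrightarrow> x < v \<Longrightarrow> v - u < e1 \<Longrightarrow> p * (v - u) \<le> f v - f u"
          unfolding A_def by blast
        obtain p' where p': "p' \<in> \<rat>" "L < p'" "p' < L + \<eta>"
          using Rats_dense_in_real[of L "L + \<eta>"] \<open>\<eta> > 0\<close> by auto
        obtain q' where q': "q' \<in> \<rat>" "p' < q'" "q' < L + \<eta>"
          using Rats_dense_in_real[of p' "L + \<eta>"] p' by auto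
        have "p' \<notin> A" using p'(2) cSup_upper[OF _ bdd, of p'] by (auto simp: L_def)
        then have "x \<in> finely_covered (\<lambda>u v. f v - f u < p' * (v - u))"
          using not_finely_covered_iff[of x "\<lambda>u v. f v - f u < p' * (v - u)"]
          unfolding A_def not_less by blast
        moreover have "x \<notin> Npq (p', q')" using x p' q' by (auto simp: N_def)
        ultimately have "x \<notin> finely_covered (\<lambda>u v. q' * (v - u) < f v - f u)"
          using x by (auto simp: Npq_def)
        then obtain e2 where e2: "e2 > 0"
            "\<And>u v. u < x \<Longrightarrow> x < v \<Longrightarrow> v - u < e2 \<Longrightarrow> f v - f u \<le> q' * (v - u)"
          unfolding not_finely_covered_iff not_less by blast
        show "\<exists>e>0. \<forall>u v. u < x \<and> x < v \<and> v - u < e \<longrightarrow>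
            \<bar>f v - f u - L * (v - u)\<bar> \<le> \<eta> * (v - u)"
        proof (intro exI[of _ "min e1 e2"] conjI allI impI)
          fix u v assume uv: "u < x \<and> x < v \<and> v - u < min e1 e2"
          have "(L - \<eta>) * (v - u) \<le> p * (v - u)" using uv p by (intro mult_right_mono) auto
          moreover have "q' * (v - u) \<le> (L + \<eta>) * (v - u)" using uv q' by (intro mult_right_mono) auto
          moreover have "p * (v - u) \<le> f v - f u" "f v - f u \<le> q' * (v - u)"
            using e1(2) e2(2) uv by auto
          ultimately have "(L - \<eta>) * (v - u) \<le> f v - f u" "f v - f u \<le> (L + \<eta>) * (v - u)"
            by linarith+
          then show "\<bar>f v - f u - L * (v - u)\<bar> \<le> \<eta> * (v - u)"
            by (simp add: abs_le_iff algebra_simps)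
        qed (use e1 e2 in auto)
      qed
      then have "0 \<le> L" using der x by blast
      then show False using L c by simp
    qed
  qed
  note cover = this
  have "\<kappa> / 2 > 0" using \<kappa> by simp
  obtain \<delta> where \<delta>: "\<delta> > 0" and small: "\<forall>(I::real set set) l r. finite I \<and>
       (\<forall>i\<in>I. l i \<le> r i \<and> {l i..r i} \<subseteq> {a..b}) \<and>
       (\<forall>i\<in>I. \<forall>j\<in>I. i \<noteq> j \<longrightarrow> {l i<..<r i} \<inter> {l j<..<r j} = {}) \<and>
       (\<Sum>i\<in>I. r i - l i) < \<delta> \<longrightarrow> (\<Sum>i\<in>I. \<bar>F (r i) - F (l i)\<bar>) < \<kappa> / 2"
    by (rule absolutely_continuous_on_indexedE[OF acF \<open>\<kappa> / 2 > 0\<close>])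
  have "\<delta> / 2 > 0" using \<delta> by simp
  obtain R where R:
      "finite R" "\<forall>K\<in>R. \<exists>u v. u \<le> v \<and> K = {u..v} \<and> {u..v} \<subseteq> {a..b}"
      "\<forall>K\<in>R. \<forall>L\<in>R. K \<noteq> L \<longrightarrow> {Inf K<..<Sup K} \<inter> {Inf L<..<Sup L} = {}"
      "(\<Sum>K\<in>R. Sup K - Inf K) \<le> measure lebesgue ({a..b} - E) + \<delta> / 2"
      "(\<Sum>K\<in>R. F (Sup K) - F (Inf K)) \<le> F b - F a"
    by (rule increment_ge_sum_over_gaps[OF ab E cover \<open>\<delta> / 2 > 0\<close>])
  have "negligible ({a, b} \<union> N)" using N by (intro negligible_Un) auto
  then have "negligible ({a..b} - E)"
    by (rule negligible_subset) (auto simp: E_def)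
  then have "measure lebesgue ({a..b} - E) = 0" by (rule negligible_imp_measure0)
  then have len: "(\<Sum>K\<in>R. Sup K - Inf K) < \<delta>" using R(4) \<delta> by linarith
  have "(\<Sum>K\<in>R. \<bar>F (Sup K) - F (Inf K)\<bar>) < \<kappa> / 2"
  proof (rule small[rule_format], intro conjI ballI impI)
    fix K assume "K \<in> R"
    then obtain u v where "u \<le> v" "K = {u..v}" "{u..v} \<subseteq> {a..b}" using R(2) by blast
    then show "Inf K \<le> Sup K" "{Inf K..Sup K} \<subseteq> {a..b}" by auto
  qed (use R(1,3) len in auto)
  then have "- (\<kappa> / 2) < (\<Sum>K\<in>R. F (Sup K) - F (Inf K))"
    using sum_abs[of "\<lambda>K. F (Sup K) - F (Inf K)" R] by linarith
  also have "\<dots> \<le> F b - F a" by (rule R(5))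
  also have "F b - F a = - \<kappa> + c * (b - a)" by (simp add: F_def \<kappa>_def algebra_simps)
  also have "c * (b - a) = \<kappa> / 2" using ab by (simp add: c_def field_simps)
  finally show False by simp
qed

section \<open>The scalar obstacle problem with a given driver\<close>

text \<open>The value of stopping a deterministic process at the cost \<open>\<gamma>\<close>, with running cost \<open>c\<close>.\<close>

definition stopping_value :: "real \<Rightarrow> (real \<Rightarrow> real) \<Rightarrow> (real \<Rightarrow> real) \<Rightarrow> real \<Rightarrow> real" where
  "stopping_value T \<gamma> c t = (INF s\<in>{t..T}. \<gamma> s + integral {t..s} c)"

definition obstacle_solution ::
  "real \<Rightarrow> (real \<Rightarrow> real) \<Rightarrow> (real \<Rightarrow> real) \<Rightarrow> (real \<Rightarrow> real) \<Rightarrow> bool" where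
  "obstacle_solution T \<gamma> c y \<longleftrightarrow>
     y T = \<gamma> T \<and>
     (\<forall>t\<in>{0..T}. y t \<le> \<gamma> t) \<and>
     (\<forall>t\<in>{0..T}. \<forall>D. (y has_real_derivative D) (at t within {0..T}) \<and> y t < \<gamma> t \<longrightarrow> D \<le> - c t) \<and>
     (\<forall>t\<in>{0..T}. \<forall>D. (y has_real_derivative D) (at t within {0..T}) \<longrightarrow> - c t \<le> D)"

lemma stopping_value_cong:
  assumes "\<And>r. t \<le> r \<Longrightarrow> r \<le> T \<Longrightarrow> c r = c' r"
  shows "stopping_value T \<gamma> c t = stopping_value T \<gamma> c' t"
proof -
  have "integral {t..s} c = integral {t..s} c'" if "s \<in> {t..T}" for s
    using assms that by (intro integral_cong) auto
  then show ?thesis unfolding stopping_value_def by (simp cong: INF_cong_simp)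
qed

lemma integral_split:
  fixes c :: "real \<Rightarrow> real"
  assumes "continuous_on {0..T} c" "0 \<le> t" "t \<le> s" "s \<le> T"
  shows "integral {0..s} c = integral {0..t} c + integral {t..s} c"
proof -
  have "c integrable_on {0..s}"
    by (intro integrable_continuous_real continuous_on_subset[OF assms(1)]) (use assms in auto)
  from Henstock_Kurzweil_Integration.integral_combine[OF assms(2,3) this] show ?thesis by simp
qed

lemma stopping_value_plus_primitive:
  assumes c: "continuous_on {0..T} c" and \<gamma>: "continuous_on {0..T} \<gamma>" and t: "0 \<le> t" "t \<le> T"
  shows "stopping_value T \<gamma> c t + integral {0..t} c = (INF s\<in>{t..T}. \<gamma> s + integral {0..s} c)"
    and "\<exists>s\<in>{t..T}. (INF s\<in>{t..T}. \<gamma> s + integral {0..s} c) = \<gamma> s + integral {0..s} c"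
    and "\<And>s. s \<in> {t..T} \<Longrightarrow> (INF s\<in>{t..T}. \<gamma> s + integral {0..s} c) \<le> \<gamma> s + integral {0..s} c"
proof -
  define f where "f s = \<gamma> s + integral {0..s} c" for s
  have "continuous_on {0..T} f"
    unfolding f_def by (intro continuous_intros \<gamma> indefinite_integral_continuous_1 integrable_continuous_real c)
  then have cont: "continuous_on {t..T} f" by (rule continuous_on_subset) (use t in auto)
  obtain x where x: "x \<in> {t..T}" "\<forall>y\<in>{t..T}. f x \<le> f y"
    using continuous_attains_inf[OF _ _ cont] t by auto
  then have eq: "(INF s\<in>{t..T}. f s) = f x"
    by (intro cInf_eq_minimum) auto
  have split: "integral {0..s} c = integral {0..t} c + integral {t..s} c" if "s \<in> {t..T}" for s
    using integral_split[OF c, of t s] t that by simp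
  have "(INF s\<in>{t..T}. \<gamma> s + integral {t..s} c) = \<gamma> x + integral {t..x} c"
  proof (rule cInf_eq_minimum)
    fix y assume "y \<in> (\<lambda>s. \<gamma> s + integral {t..s} c) ` {t..T}"
    then obtain s where s: "s \<in> {t..T}" "y = \<gamma> s + integral {t..s} c" by blast
    have "f x \<le> f s" using x(2) s(1) by blast
    then show "\<gamma> x + integral {t..x} c \<le> y"
      using split[OF x(1)] split[OF s(1)] s(2) by (simp add: f_def)
  qed (use x in auto)
  then show "stopping_value T \<gamma> c t + integral {0..t} c = (INF s\<in>{t..T}. \<gamma> s + integral {0..s} c)"
    using eq split[OF x(1)] by (simp add: stopping_value_def f_def)
  show "\<exists>s\<in>{t..T}. (INF s\<in>{t..T}. \<gamma> s + integral {0..s} c) = \<gamma> s + integral {0..s} c"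
    using eq x(1) by (auto simp: f_def)
  show "(INF s\<in>{t..T}. \<gamma> s + integral {0..s} c) \<le> \<gamma> s + integral {0..s} c" if "s \<in> {t..T}" for s
    using eq x(2) that by (simp add: f_def)
qed

lemma stopping_value_diff_le:
  assumes c: "continuous_on {0..T} c" and c': "continuous_on {0..T} c'"
    and \<gamma>: "continuous_on {0..T} \<gamma>" and t: "0 \<le> t" "t \<le> T"
    and e: "\<And>s. s \<in> {t..T} \<Longrightarrow> integral {t..s} c \<le> integral {t..s} c' + e"
  shows "stopping_value T \<gamma> c t \<le> stopping_value T \<gamma> c' t + e"
proof -
  have split: "integral {0..s} b = integral {0..t} b + integral {t..s} b"
    if "s \<in> {t..T}" "continuous_on {0..T} b" for s and b :: "real \<Rightarrow> real"
    using integral_split[of T b t s] t that by simp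
  obtain s where s: "s \<in> {t..T}"
    "(INF s\<in>{t..T}. \<gamma> s + integral {0..s} c') = \<gamma> s + integral {0..s} c'"
    using stopping_value_plus_primitive(2)[OF c' \<gamma> t] by blast
  have "stopping_value T \<gamma> c' t = \<gamma> s + integral {t..s} c'"
    using stopping_value_plus_primitive(1)[OF c' \<gamma> t] s split[OF s(1) c'] by simp
  moreover have "stopping_value T \<gamma> c t \<le> \<gamma> s + integral {t..s} c"
    using stopping_value_plus_primitive(1)[OF c \<gamma> t]
      stopping_value_plus_primitive(3)[OF c \<gamma> t s(1)] split[OF s(1) c] by simp
  ultimately show ?thesis using e[OF s(1)] by simp
qed

text \<open>The exponential weight is integrated along with the difference of the drivers and produces the
  factor \<open>1 / l\<close> that makes the solution operator contracting.\<close>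

lemma stopping_value_dist_le:
  assumes c: "continuous_on {0..T} c" and c': "continuous_on {0..T} c'"
    and \<gamma>: "continuous_on {0..T} \<gamma>" and t: "0 \<le> t" "t \<le> T" and l: "l > 0" and M: "M \<ge> 0"
    and diff: "\<And>r. r \<in> {0..T} \<Longrightarrow> \<bar>c r - c' r\<bar> \<le> M * exp (- (l * r))"
  shows "\<bar>stopping_value T \<gamma> c t - stopping_value T \<gamma> c' t\<bar> \<le> M / l * exp (- (l * t))"
proof -
  have int: "\<bar>integral {t..s} c - integral {t..s} c'\<bar> \<le> M / l * exp (- (l * t))" if s: "s \<in> {t..T}" for s
  proof -
    have ints: "c integrable_on {t..s}" "c' integrable_on {t..s}"
      by (intro integrable_continuous_real continuous_on_subset[OF c] continuous_on_subset[OF c'];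
          use s t in auto)+
    have "((\<lambda>r. M * exp (- (l * r))) has_integral
        (- (M / l) * exp (- (l * s)) - - (M / l) * exp (- (l * t)))) {t..s}"
    proof (rule fundamental_theorem_of_calculus)
      show "t \<le> s" using s by simp
      show "((\<lambda>r. - (M / l) * exp (- (l * r))) has_vector_derivative M * exp (- (l * r))) (at r within {t..s})" for r
        unfolding has_real_derivative_iff_has_vector_derivative[symmetric]
        using l by (auto intro!: derivative_eq_intros)
    qed
    note FTC = this
    have "norm (integral {t..s} (\<lambda>r. c r - c' r)) \<le> integral {t..s} (\<lambda>r. M * exp (- (l * r)))"
      using FTC diff s t ints
      by (intro integral_norm_bound_integral integrable_diff) auto
    also have "\<dots> = M / l * exp (- (l * t)) - M / l * exp (- (l * s))"
      using integral_unique[OF FTC] by simp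
    also have "\<dots> \<le> M / l * exp (- (l * t))" using M l by simp
    finally show ?thesis using integral_diff[OF ints] by simp
  qed
  have "stopping_value T \<gamma> c t \<le> stopping_value T \<gamma> c' t + M / l * exp (- (l * t))"
    using int by (intro stopping_value_diff_le c c' \<gamma> t) (simp add: abs_le_iff algebra_simps)
  moreover have "stopping_value T \<gamma> c' t \<le> stopping_value T \<gamma> c t + M / l * exp (- (l * t))"
    using int by (intro stopping_value_diff_le c c' \<gamma> t) (simp add: abs_le_iff algebra_simps)
  ultimately show ?thesis by (simp add: abs_le_iff)
qed

lemma lipschitz_on_primitive:
  assumes c: "continuous_on {0..T} (c :: real \<Rightarrow> real)"
  shows "\<exists>L. L-lipschitz_on {0..T} (\<lambda>t. integral {0..t} c)"
proof -
  have "bounded (c ` {0..T})" using c by (intro compact_imp_bounded compact_continuous_image) auto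
  then obtain B where B: "B > 0" "\<And>r. r \<in> {0..T} \<Longrightarrow> \<bar>c r\<bar> \<le> B" unfolding bounded_pos by auto
  have *: "\<bar>integral {0..y} c - integral {0..x} c\<bar> \<le> B * (y - x)"
    if "0 \<le> x" "x \<le> y" "y \<le> T" for x y
  proof -
    have "integral {0..y} c - integral {0..x} c = integral {x..y} c"
      using integral_split[OF c that] by simp
    moreover have "norm (integral {x..y} c) \<le> B * (y - x)"
      using that B(2) by (intro integral_bound continuous_on_subset[OF c]) auto
    ultimately show ?thesis by simp
  qed
  have "B-lipschitz_on {0..T} (\<lambda>t. integral {0..t} c)"
  proof (rule lipschitz_onI)
    show "0 \<le> B" using B by simp
    fix x y assume "x \<in> {0..T}" "y \<in> {0..T}"
    then show "dist (integral {0..x} c) (integral {0..y} c) \<le> B * dist x y"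
      using *[of x y] *[of y x] by (cases "x \<le> y") (auto simp: dist_real_def abs_minus_commute)
  qed
  then show ?thesis by blast
qed

text \<open>The function \<open>y + C\<close> is nondecreasing, so \<open>y + C \<le> \<gamma> + C\<close> at all later times bounds it by
  the infimum. Up to the first contact with the obstacle it is also nonincreasing, so the
  bound is attained there.\<close>

lemma obstacle_solution_imp_stopping_value:
  assumes c: "continuous_on {0..T} c" and \<gamma>: "continuous_on {0..T} \<gamma>"
    and ac: "absolutely_continuous_on {0..T} y" and sol: "obstacle_solution T \<gamma> c y"
    and t: "0 \<le> t" "t \<le> T"
  shows "y t = stopping_value T \<gamma> c t"
proof -
  have sol_T: "y T = \<gamma> T" and sol_le: "\<And>s. s \<in> {0..T} \<Longrightarrow> y s \<le> \<gamma> s"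
    and sol_upper: "\<And>s D. s \<in> {0..T} \<Longrightarrow> (y has_real_derivative D) (at s within {0..T}) \<Longrightarrow>
      y s < \<gamma> s \<Longrightarrow> D \<le> - c s"
    and sol_lower: "\<And>s D. s \<in> {0..T} \<Longrightarrow> (y has_real_derivative D) (at s within {0..T}) \<Longrightarrow> - c s \<le> D"
    using sol unfolding obstacle_solution_def by blast+
  define C where "C s = integral {0..s} c" for s
  have derC: "(C has_real_derivative c r) (at r within {0..T})" if "r \<in> {0..T}" for r
    unfolding C_def using integral_has_real_derivative[OF c that] .
  have acC: "absolutely_continuous_on {0..T} C"
    using lipschitz_on_primitive[OF c] lipschitz_on_imp_absolutely_continuous_on
    unfolding C_def by blast
  define F where "F s = y s + C s" for s
  have acF: "absolutely_continuous_on {0..T} F"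
    using absolutely_continuous_on_add[OF ac acC] by (simp add: F_def[abs_def])
  have dery: "(y has_real_derivative D - c r) (at r within {0..T})"
    if "(F has_real_derivative D) (at r)" "r \<in> {0..T}" for D r
  proof -
    have "((\<lambda>s. F s - C s) has_real_derivative D - c r) (at r within {0..T})"
      by (intro DERIV_diff has_field_derivative_at_within[OF that(1)] derC that(2))
    then show ?thesis by (simp add: F_def)
  qed
  have mono: "F r \<le> F s" if "0 \<le> r" "r \<le> s" "s \<le> T" for r s
  proof (rule absolutely_continuous_nonneg_derivative_imp_le[of r s F])
    show "absolutely_continuous_on {r..s} F"
      by (rule absolutely_continuous_on_subset[OF acF]) (use that in auto)
    fix x D assume x: "r < x" "x < s" and D: "(F has_real_derivative D) (at x)"
    have "x \<in> {0..T}" using x that by auto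
    then have "- c x \<le> D - c x" using sol_lower dery[OF D] by blast
    then show "0 \<le> D" by simp
  qed (use that in auto)
  note V = stopping_value_plus_primitive[OF c \<gamma> t, folded C_def]
  show ?thesis
  proof (rule antisym)
    obtain s where s: "s \<in> {t..T}" "(INF s\<in>{t..T}. \<gamma> s + C s) = \<gamma> s + C s" using V(2) by blast
    have "F t \<le> F s" using mono t s by auto
    also have "\<dots> \<le> \<gamma> s + C s" using sol_le[of s] s(1) t by (simp add: F_def)
    finally show "y t \<le> stopping_value T \<gamma> c t" using V(1) s(2) by (simp add: F_def)
  next
    \<comment> \<open>the contact set; its least element is an optimal stopping time\<close>
    define Z where "Z = {s \<in> {t..T}. y s - \<gamma> s = 0}"
    have "continuous_on {t..T} (\<lambda>s. y s - \<gamma> s)"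
      using t by (intro continuous_intros continuous_on_subset[OF \<gamma>]
          continuous_on_subset[OF absolutely_continuous_on_imp_continuous_on[OF ac]]) auto
    then have "closed Z" unfolding Z_def by (intro continuous_closed_preimage_constant) auto
    moreover have "bounded Z" by (rule bounded_subset[of "{t..T}"]) (auto simp: Z_def)
    ultimately have "compact Z" by (simp add: compact_eq_bounded_closed)
    moreover have "T \<in> Z" using sol_T t by (simp add: Z_def)
    ultimately obtain s where s: "s \<in> Z" "\<forall>r\<in>Z. s \<le> r"
      using compact_attains_inf[of Z] by blast
    have st: "t \<le> s" "s \<le> T" "y s = \<gamma> s" using s(1) by (auto simp: Z_def)
    have "- F t \<le> - F s"
    proof (rule absolutely_continuous_nonneg_derivative_imp_le[of t s "\<lambda>s. - F s"])
      show "absolutely_continuous_on {t..s} (\<lambda>s. - F s)"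
        by (intro absolutely_continuous_on_uminus absolutely_continuous_on_subset[OF acF]) (use t st in auto)
      fix x D assume x: "t < x" "x < s" and D: "((\<lambda>s. - F s) has_real_derivative D) (at x)"
      have "(F has_real_derivative - D) (at x)" using DERIV_minus[OF D] by simp
      moreover have xT: "x \<in> {0..T}" using x t st by auto
      ultimately have "(y has_real_derivative - D - c x) (at x within {0..T})" by (rule dery)
      moreover have "y x < \<gamma> x"
      proof -
        have "x \<notin> Z" using s(2) x by force
        moreover have "y x \<le> \<gamma> x" using sol_le[OF xT] .
        ultimately show ?thesis using x st by (auto simp: Z_def)
      qed
      ultimately have "- D - c x \<le> - c x" by (rule sol_upper[OF xT])
      then show "0 \<le> D" by simp
    qed (use st in auto)
    then have "\<gamma> s + C s \<le> F t" using st by (simp add: F_def)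
    moreover have "(INF s\<in>{t..T}. \<gamma> s + C s) \<le> \<gamma> s + C s" using V(3) st by auto
    ultimately show "stopping_value T \<gamma> c t \<le> y t" using V(1) by (simp add: F_def)
  qed
qed

text \<open>The infimum \<open>m\<close> of \<open>f = \<gamma> + C\<close> over \<open>[t,T]\<close> inherits the Lipschitz constant of \<open>f\<close>. It is
  nondecreasing in \<open>t\<close>. If it lies below \<open>f\<close> at \<open>t\<close> then it is attained at some later time and
  constant up to that time, and this one-sided information fixes the derivative whenever it exists.\<close>

lemma stopping_value_imp_obstacle_solution:
  assumes T: "T > 0" and c: "continuous_on {0..T} c" and lip: "L-lipschitz_on {0..T} \<gamma>"
    and y: "\<And>t. t \<in> {0..T} \<Longrightarrow> y t = stopping_value T \<gamma> c t"
  shows "absolutely_continuous_on {0..T} y" and "obstacle_solution T \<gamma> c y"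
proof -
  define C where "C s = integral {0..s} c" for s
  have derC: "(C has_real_derivative c r) (at r within {0..T})" if "r \<in> {0..T}" for r
    unfolding C_def using integral_has_real_derivative[OF c that] .
  obtain B where lipC: "B-lipschitz_on {0..T} C"
    using lipschitz_on_primitive[OF c] unfolding C_def by blast
  have \<gamma>: "continuous_on {0..T} \<gamma>" by (rule lipschitz_on_continuous_on[OF lip])
  note V = stopping_value_plus_primitive[OF c \<gamma>, folded C_def]
  define f where "f s = \<gamma> s + C s" for s
  have lipf: "(L + B)-lipschitz_on {0..T} f"
    unfolding f_def by (rule lipschitz_on_add[OF lip lipC])
  define m where "m s = y s + C s" for s
  have m_le: "m t \<le> f s" if "0 \<le> t" "t \<le> s" "s \<le> T" for t s
    using V(1)[of t] V(3)[of t s] y[of t] that by (simp add: m_def f_def)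
  have m_att: "\<exists>s\<in>{t..T}. m t = f s" if "0 \<le> t" "t \<le> T" for t
    using V(1,2)[of t] y[of t] that by (simp add: m_def f_def)
  have m_mono: "m t \<le> m s" if "0 \<le> t" "t \<le> s" "s \<le> T" for t s
    using m_att[of s] m_le[of t] that by fastforce
  have m_diff: "m s - m t \<le> (L + B) * (s - t)" if ts: "0 \<le> t" "t \<le> s" "s \<le> T" for t s
  proof -
    have LB: "L + B \<ge> 0" using lipschitz_on_nonneg[OF lipf] .
    obtain r where r: "r \<in> {t..T}" "m t = f r" using m_att[of t] ts by auto
    show ?thesis
    proof (cases "s \<le> r")
      case True
      then have "m s \<le> m t" using m_le[of s r] r ts by auto
      then show ?thesis using LB ts by (smt (verit) mult_nonneg_nonneg)
    next
      case False
      have "f s - f r \<le> (L + B) * (s - r)"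
        using lipschitz_onD[OF lipf, of s r] r ts False by (auto simp: dist_real_def)
      also have "\<dots> \<le> (L + B) * (s - t)" using LB r by (intro mult_left_mono) auto
      finally show ?thesis using m_le[of s s] r ts by auto
    qed
  qed
  have lipm: "(L + B)-lipschitz_on {0..T} m"
  proof (rule lipschitz_onI)
    show "0 \<le> L + B" using lipschitz_on_nonneg[OF lipf] .
    fix t s assume "t \<in> {0..T}" "s \<in> {0..T}"
    then show "dist (m t) (m s) \<le> (L + B) * dist t s"
      using m_mono[of t s] m_diff[of t s] m_mono[of s t] m_diff[of s t]
      by (cases "t \<le> s") (auto simp: dist_real_def)
  qed
  have "absolutely_continuous_on {0..T} (\<lambda>s. m s + - C s)"
    by (intro absolutely_continuous_on_add absolutely_continuous_on_uminus
        lipschitz_on_imp_absolutely_continuous_on[OF lipm] lipschitz_on_imp_absolutely_continuous_on[OF lipC])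
  then show "absolutely_continuous_on {0..T} y" by (simp add: m_def)
  have derm: "(m has_real_derivative D + c t) (at t within {0..T})"
    if "(y has_real_derivative D) (at t within {0..T})" "t \<in> {0..T}" for D t
    unfolding m_def by (intro DERIV_add that derC)
  have lower: "- c t \<le> D" if t: "t \<in> {0..T}" and D: "(y has_real_derivative D) (at t within {0..T})" for t D
  proof -
    have "((\<lambda>s. (m s - m t) / (s - t)) \<longlongrightarrow> D + c t) (at t within {0..T})"
      using derm[OF D t] by (simp add: has_field_derivative_iff)
    moreover have "\<forall>\<^sub>F s in at t within {0..T}. 0 \<le> (m s - m t) / (s - t)"
      unfolding eventually_at_filter
    proof (intro always_eventually allI impI)
      fix s assume "s \<noteq> t" "s \<in> {0..T}"
      then show "0 \<le> (m s - m t) / (s - t)"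
        using m_mono[of t s] m_mono[of s t] t by (cases "t \<le> s") (auto intro: divide_nonpos_nonpos)
    qed
    moreover have "at t within {0..T} \<noteq> bot"
      using islimpt_Icc[OF T, of t] t by (simp add: trivial_limit_within)
    ultimately have "0 \<le> D + c t" by (rule tendsto_lowerbound)
    then show ?thesis by simp
  qed
  have upper: "D \<le> - c t"
    if t: "t \<in> {0..T}" and D: "(y has_real_derivative D) (at t within {0..T})" and "y t < \<gamma> t" for t D
  proof -
    have lt: "m t < f t" using that(3) by (simp add: m_def f_def)
    obtain s where s: "s \<in> {t..T}" "m t = f s" using m_att[of t] t by auto
    then have "t < s" using lt by (cases "s = t") auto
    have const: "m r = m t" if "r \<in> {t..s}" for r
      using m_mono[of t r] m_le[of r s] that s t by auto
    have "((\<lambda>r. (m r - m t) / (r - t)) \<longlongrightarrow> D + c t) (at t within {t..s})"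
      using has_field_derivative_subset[OF derm[OF D t], of "{t..s}"] s t
      by (auto simp: has_field_derivative_iff)
    moreover have "((\<lambda>r. (m r - m t) / (r - t)) \<longlongrightarrow> 0) (at t within {t..s})"
    proof (rule tendsto_eventually, unfold eventually_at_filter, intro always_eventually allI impI)
      fix r assume "r \<in> {t..s}"
      from const[OF this] show "(m r - m t) / (r - t) = 0" by simp
    qed
    moreover have "at t within {t..s} \<noteq> bot"
      using islimpt_Icc[OF \<open>t < s\<close>, of t] \<open>t < s\<close> by (simp add: trivial_limit_within)
    ultimately have "D + c t = 0" using tendsto_unique by blast
    then show ?thesis by simp
  qed
  have "y t \<le> \<gamma> t" if "t \<in> {0..T}" for t
    using m_le[of t t] that by (simp add: m_def f_def)
  moreover have "y T = \<gamma> T"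
    using m_att[of T] T by (simp add: m_def f_def)
  ultimately show "obstacle_solution T \<gamma> c y"
    unfolding obstacle_solution_def using lower upper by blast
qed

section \<open>The coupled system as a contraction\<close>

lemma clamped_bcontfun:
  fixes f :: "real \<Rightarrow> 'a::metric_space"
  assumes "T \<ge> 0" "continuous_on {0..T} f"
  shows "(\<lambda>t. f (max 0 (min T t))) \<in> bcontfun"
  unfolding bcontfun_def
proof (intro CollectI conjI)
  have *: "max 0 (min T t) \<in> {0..T}" for t using assms(1) by auto
  show "continuous_on UNIV (\<lambda>t. f (max 0 (min T t)))"
    by (rule continuous_on_compose2[OF assms(2)]) (use * in \<open>auto intro!: continuous_intros\<close>)
  have "bounded (f ` {0..T})" using assms(2) by (intro compact_imp_bounded compact_continuous_image) auto
  then show "bounded (range (\<lambda>t. f (max 0 (min T t))))"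
    by (rule bounded_subset) (use * in blast)
qed

text \<open>Banach's theorem is applied to \<open>z(t) = exp (l t) w(t)\<close>, so that the weighted norm of \<open>w\<close> is the
  supremum norm of \<open>z\<close>. Curves on \<open>[0,T]\<close> are extended by their end values in order to live in a
  complete space of functions on the whole line.\<close>

lemma stopping_value_system_fixed_point:
  fixes H :: "'d::finite \<Rightarrow> real \<Rightarrow> real ^ 'd \<Rightarrow> real" and g :: "real \<Rightarrow> 'd \<Rightarrow> real"
  assumes T: "T > 0" and K: "K > 0"
    and Hcont: "\<And>i w. continuous_on {0..T} w \<Longrightarrow> continuous_on {0..T} (\<lambda>s. H i s (w s))"
    and Hlip: "\<And>i s w w'. s \<in> {0..T} \<Longrightarrow> \<bar>H i s w - H i s w'\<bar> \<le> K * norm (w - w')"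
    and g: "\<And>i. \<exists>L. L-lipschitz_on {0..T} (\<lambda>t. g t i)"
  defines "fp \<equiv> \<lambda>w. \<forall>t\<in>{0..T}. \<forall>i. w t $ i = stopping_value T (\<lambda>s. g s i) (\<lambda>s. H i s (w s)) t"
  shows "\<exists>w. continuous_on {0..T} w \<and> fp w"
    and "\<And>w w' t. continuous_on {0..T} w \<Longrightarrow> fp w \<Longrightarrow> continuous_on {0..T} w' \<Longrightarrow> fp w' \<Longrightarrow>
      t \<in> {0..T} \<Longrightarrow> w t = w' t"
proof -
  define cl where "cl t = max 0 (min T t)" for t
  have cl: "cl t \<in> {0..T}" "t \<in> {0..T} \<Longrightarrow> cl t = t" for t using T by (auto simp: cl_def)
  \<comment> \<open>The Euclidean norm is bounded by the sum of the components; this weight then gives the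
    contraction factor 1/2.\<close>
  define l where "l = 2 * K * real CARD('d)"
  have l: "l > 0" using K by (simp add: l_def)
  define W :: "(real \<Rightarrow>\<^sub>C (real ^ 'd)) \<Rightarrow> real \<Rightarrow> real ^ 'd"
    where "W z s = exp (- (l * s)) *\<^sub>R apply_bcontfun z s" for z s
  have Wcont: "continuous_on A (W z)" for z A
    unfolding W_def by (intro continuous_intros continuous_on_apply_bcontfun)
  define V where "V z t = (\<chi> i. stopping_value T (\<lambda>s. g s i) (\<lambda>s. H i s (W z s)) t)" for z t
  have \<gamma>: "continuous_on {0..T} (\<lambda>s. g s i)" for i
    using g[of i] lipschitz_on_continuous_on by blast
  have HW: "continuous_on {0..T} (\<lambda>s. H i s (W z s))" for i z by (rule Hcont[OF Wcont])
  have Vcont: "continuous_on {0..T} (V z)" for z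
    unfolding V_def
  proof (rule continuous_on_vec_lambda)
    fix i
    obtain L where "L-lipschitz_on {0..T} (\<lambda>t. g t i)" using g by blast
    from stopping_value_imp_obstacle_solution(1)[OF T HW this refl]
    show "continuous_on {0..T} (stopping_value T (\<lambda>s. g s i) (\<lambda>s. H i s (W z s)))"
      by (rule absolutely_continuous_on_imp_continuous_on)
  qed
  define \<Psi> where "\<Psi> z = Bcontfun (\<lambda>t. exp (l * cl t) *\<^sub>R V z (cl t))" for z
  have \<Psi>: "apply_bcontfun (\<Psi> z) t = exp (l * cl t) *\<^sub>R V z (cl t)" for z t
  proof -
    have "continuous_on {0..T} (\<lambda>t. exp (l * t) *\<^sub>R V z t)" by (intro continuous_intros Vcont)
    then have "(\<lambda>t. exp (l * cl t) *\<^sub>R V z (cl t)) \<in> bcontfun"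
      unfolding cl_def using T by (intro clamped_bcontfun) auto
    then show ?thesis by (simp add: \<Psi>_def Bcontfun_inverse)
  qed
  have contr: "dist (\<Psi> z) (\<Psi> z') \<le> 1 / 2 * dist z z'" for z z'
  proof (rule dist_bound)
    fix t
    define \<tau> where "\<tau> = cl t"
    have \<tau>: "0 \<le> \<tau>" "\<tau> \<le> T" using cl(1)[of t] by (auto simp: \<tau>_def)
    have comp: "\<bar>V z \<tau> $ i - V z' \<tau> $ i\<bar> \<le> K * dist z z' / l * exp (- (l * \<tau>))" for i
      unfolding V_def vec_lambda_beta
    proof (rule stopping_value_dist_le[OF HW HW \<gamma> \<tau> l])
      show "0 \<le> K * dist z z'" using K by simp
      fix r assume r: "r \<in> {0..T}"
      have "\<bar>H i r (W z r) - H i r (W z' r)\<bar> \<le> K * norm (W z r - W z' r)" by (rule Hlip[OF r])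
      also have "W z r - W z' r = exp (- (l * r)) *\<^sub>R (apply_bcontfun z r - apply_bcontfun z' r)"
        by (simp add: W_def scaleR_diff_right)
      also have "K * norm \<dots> = K * (exp (- (l * r)) * dist (apply_bcontfun z r) (apply_bcontfun z' r))"
        by (simp add: dist_norm)
      also have "\<dots> \<le> K * (exp (- (l * r)) * dist z z')"
        using K by (intro mult_left_mono dist_bounded) auto
      finally show "\<bar>H i r (W z r) - H i r (W z' r)\<bar> \<le> K * dist z z' * exp (- (l * r))"
        by (simp add: mult_ac)
    qed
    have "norm (V z \<tau> - V z' \<tau>) \<le> (\<Sum>i\<in>UNIV. \<bar>(V z \<tau> - V z' \<tau>) $ i\<bar>)" by (rule norm_le_l1_cart)
    also have "\<dots> \<le> (\<Sum>i\<in>(UNIV::'d set). K * dist z z' / l * exp (- (l * \<tau>)))"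
      using comp by (intro sum_mono) simp
    also have "\<dots> = 1 / 2 * dist z z' * exp (- (l * \<tau>))"
      using K by (simp add: l_def)
    finally have "exp (l * \<tau>) * norm (V z \<tau> - V z' \<tau>) \<le> exp (l * \<tau>) * (1 / 2 * dist z z' * exp (- (l * \<tau>)))"
      by (intro mult_left_mono) auto
    also have "\<dots> = 1 / 2 * dist z z'" by (simp add: exp_minus)
    finally show "dist (apply_bcontfun (\<Psi> z) t) (apply_bcontfun (\<Psi> z') t) \<le> 1 / 2 * dist z z'"
      by (simp add: \<Psi> dist_norm \<tau>_def flip: scaleR_diff_right)
  qed
  have unique: "\<exists>!z. \<Psi> z = z"
    by (rule banach_fix_type[of "1 / 2"]) (use contr in auto)
  then obtain z where z: "\<Psi> z = z" by blast
  have "fp (W z)"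
    unfolding fp_def
  proof (intro ballI allI)
    fix t i assume t: "t \<in> {0..T}"
    have "W z t = exp (- (l * t)) *\<^sub>R apply_bcontfun (\<Psi> z) t" by (simp add: z W_def)
    also have "\<dots> = V z t" using cl(2)[OF t] by (simp add: \<Psi> exp_minus)
    finally show "W z t $ i = stopping_value T (\<lambda>s. g s i) (\<lambda>s. H i s (W z s)) t"
      by (simp add: V_def)
  qed
  then show "\<exists>w. continuous_on {0..T} w \<and> fp w" using Wcont by blast
  define Z where "Z w = Bcontfun (\<lambda>t. exp (l * cl t) *\<^sub>R w (cl t))" for w :: "real \<Rightarrow> real ^ 'd"
  have Z: "apply_bcontfun (Z w) t = exp (l * cl t) *\<^sub>R w (cl t)" if "continuous_on {0..T} w" for w t
  proof -
    have "continuous_on {0..T} (\<lambda>t. exp (l * t) *\<^sub>R w t)" by (intro continuous_intros that)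
    then have "(\<lambda>t. exp (l * cl t) *\<^sub>R w (cl t)) \<in> bcontfun"
      unfolding cl_def using T by (intro clamped_bcontfun) auto
    then show ?thesis by (simp add: Z_def Bcontfun_inverse)
  qed
  have fixed: "\<Psi> (Z w) = Z w" if w: "continuous_on {0..T} w" "fp w" for w
  proof (rule bcontfun_eqI)
    fix t
    have WZ: "W (Z w) r = w r" if "r \<in> {0..T}" for r
      using cl(2)[OF that] by (simp add: W_def Z[OF w(1)] exp_minus)
    have "V (Z w) \<tau> $ i = w \<tau> $ i" if "\<tau> \<in> {0..T}" for i \<tau>
    proof -
      have "stopping_value T (\<lambda>s. g s i) (\<lambda>s. H i s (W (Z w) s)) \<tau>
          = stopping_value T (\<lambda>s. g s i) (\<lambda>s. H i s (w s)) \<tau>"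
        using that WZ by (intro stopping_value_cong) auto
      then show ?thesis using w(2) that by (simp add: V_def fp_def)
    qed
    then show "apply_bcontfun (\<Psi> (Z w)) t = apply_bcontfun (Z w) t"
      using cl(1)[of t] by (simp add: \<Psi> Z[OF w(1)] vec_eq_iff)
  qed
  show "w t = w' t" if w: "continuous_on {0..T} w" "fp w" "continuous_on {0..T} w'" "fp w'"
    and t: "t \<in> {0..T}" for w w' t
  proof -
    have "Z w = Z w'" using unique fixed[OF w(1,2)] fixed[OF w(3,4)] by blast
    then have "apply_bcontfun (Z w) t = apply_bcontfun (Z w') t" by simp
    then show ?thesis using cl(2)[OF t] by (simp add: Z w)
  qed
qed

section \<open>Regularity of the Hamiltonian\<close>

lemma minmax_le_add:
  fixes F G :: "'u \<Rightarrow> 'v \<Rightarrow> real"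
  assumes "U \<noteq> {}" "V \<noteq> {}"
    and F: "\<And>u v. u \<in> U \<Longrightarrow> v \<in> V \<Longrightarrow> \<bar>F u v\<bar> \<le> B"
    and G: "\<And>u v. u \<in> U \<Longrightarrow> v \<in> V \<Longrightarrow> \<bar>G u v\<bar> \<le> B"
    and le: "\<And>u v. u \<in> U \<Longrightarrow> v \<in> V \<Longrightarrow> F u v \<le> G u v + e"
  shows "minmax U V F \<le> minmax U V G + e"
proof -
  obtain v0 where v0: "v0 \<in> V" using assms(2) by blast
  have bF: "bdd_above (F u ` V)" if "u \<in> U" for u
    using F[OF that] by (intro bdd_aboveI2[of _ _ B]) (auto simp: abs_le_iff)
  have bG: "bdd_above (G u ` V)" if "u \<in> U" for u
    using G[OF that] by (intro bdd_aboveI2[of _ _ B]) (auto simp: abs_le_iff)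
  have "- B \<le> (SUP v\<in>V. F u v)" if "u \<in> U" for u
  proof -
    have "- B \<le> F u v0" using F[OF that v0] by (simp add: abs_le_iff)
    also have "\<dots> \<le> (SUP v\<in>V. F u v)" by (rule cSUP_upper[OF v0 bF[OF that]])
    finally show ?thesis .
  qed
  then have bI: "bdd_below ((\<lambda>u. SUP v\<in>V. F u v) ` U)" by (intro bdd_belowI2)
  have "minmax U V F - e \<le> (SUP v\<in>V. G u v)" if u: "u \<in> U" for u
  proof -
    have "minmax U V F \<le> (SUP v\<in>V. F u v)" unfolding minmax_def by (rule cINF_lower[OF bI u])
    also have "\<dots> \<le> (SUP v\<in>V. G u v) + e"
    proof (rule cSUP_least[OF assms(2)])
      fix v assume v: "v \<in> V"
      have "G u v \<le> (SUP v\<in>V. G u v)" by (rule cSUP_upper[OF v bG[OF u]])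
      then show "F u v \<le> (SUP v\<in>V. G u v) + e" using le[OF u v] by simp
    qed
    finally show ?thesis by simp
  qed
  then have "minmax U V F - e \<le> minmax U V G"
    unfolding minmax_def[of U V G] by (intro cINF_greatest assms(1))
  then show ?thesis by simp
qed

lemma minmax_nonexpansive:
  fixes F G :: "'u \<Rightarrow> 'v \<Rightarrow> real"
  assumes "U \<noteq> {}" "V \<noteq> {}"
    and F: "\<And>u v. u \<in> U \<Longrightarrow> v \<in> V \<Longrightarrow> \<bar>F u v\<bar> \<le> B"
    and le: "\<And>u v. u \<in> U \<Longrightarrow> v \<in> V \<Longrightarrow> \<bar>F u v - G u v\<bar> \<le> e"
  shows "\<bar>minmax U V F - minmax U V G\<bar> \<le> e"
proof -
  obtain u0 v0 where "u0 \<in> U" "v0 \<in> V" using assms(1,2) by blast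
  then have e: "0 \<le> e" using le[of u0 v0] by linarith
  have G: "\<bar>G u v\<bar> \<le> B + e" if "u \<in> U" "v \<in> V" for u v
    using F[OF that] le[OF that] by linarith
  have F': "\<bar>F u v\<bar> \<le> B + e" if "u \<in> U" "v \<in> V" for u v
    using F[OF that] e by linarith
  have le': "F u v \<le> G u v + e" "G u v \<le> F u v + e" if "u \<in> U" "v \<in> V" for u v
    using le[OF that] by linarith+
  have "minmax U V F \<le> minmax U V G + e"
    by (rule minmax_le_add[OF assms(1,2) F' G le'(1)])
  moreover have "minmax U V G \<le> minmax U V F + e"
    by (rule minmax_le_add[OF assms(1,2) G F' le'(2)])
  ultimately show ?thesis by (simp add: abs_le_iff)
qed

lemma continuous_on_compact_bounded:
  fixes f :: "'a::topological_space \<Rightarrow> real"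
  assumes "compact S" "continuous_on S f"
  obtains B where "B \<ge> 0" "\<And>x. x \<in> S \<Longrightarrow> \<bar>f x\<bar> \<le> B"
proof -
  have "bounded (f ` S)" using assms by (intro compact_imp_bounded compact_continuous_image)
  then show ?thesis using that unfolding bounded_pos by (auto intro: less_imp_le)
qed

lemma pre_hamiltonian_continuous:
  fixes U :: "'u::topological_space set" and V :: "'v::topological_space set"
    and Q :: "real \<Rightarrow> 'u \<Rightarrow> 'v \<Rightarrow> real ^ 'd::finite ^ 'd"
  assumes Q: "\<And>i j. continuous_on ({0..T} \<times> U \<times> V) (\<lambda>(t, u, v). Q t u v $ i $ j)"
    and h: "\<And>i. continuous_on ({0..T} \<times> U \<times> V) (\<lambda>(t, u, v). h t i u v)"
    and w: "continuous_on {0..T} w"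
  shows "continuous_on ({0..T} \<times> U \<times> V) (\<lambda>(t, u, v). pre_hamiltonian Q h t i (w t) u v)"
proof -
  have "continuous_on ({0..T} \<times> U \<times> V) (\<lambda>x. w (fst x))"
    by (rule continuous_on_compose2[OF w continuous_on_fst[OF continuous_on_id]]) auto
  note w_cont = continuous_on_component[OF this]
  show ?thesis
    unfolding pre_hamiltonian_def case_prod_beta
    by (intro continuous_on_add continuous_on_sum continuous_on_mult w_cont
        Q[unfolded case_prod_beta] h[unfolded case_prod_beta])
qed

text \<open>By compactness of \<open>U \<times> V\<close> the payoff is continuous in time uniformly in the controls, and taking
  extrema does not increase distances.\<close>

lemma hamiltonian_continuous:
  fixes U :: "'u::topological_space set" and V :: "'v::topological_space set"
    and Q :: "real \<Rightarrow> 'u \<Rightarrow> 'v \<Rightarrow> real ^ 'd::finite ^ 'd"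
  assumes U: "compact U" "U \<noteq> {}" and V: "compact V" "V \<noteq> {}"
    and Q: "\<And>i j. continuous_on ({0..T} \<times> U \<times> V) (\<lambda>(t, u, v). Q t u v $ i $ j)"
    and h: "\<And>i. continuous_on ({0..T} \<times> U \<times> V) (\<lambda>(t, u, v). h t i u v)"
    and w: "continuous_on {0..T} w"
  shows "continuous_on {0..T} (\<lambda>s. hamiltonian U V Q h i s (w s))"
  unfolding continuous_on_def
proof (intro ballI tendstoI)
  fix s0 e :: real assume s0: "s0 \<in> {0..T}" and e: "e > 0"
  define F where "F = (\<lambda>(t, u, v). pre_hamiltonian Q h t i (w t) u v)"
  have F: "continuous_on ({0..T} \<times> U \<times> V) F"
    unfolding F_def by (rule pre_hamiltonian_continuous[OF Q h w])
  have cUV: "compact (U \<times> V)" using U V by (intro compact_Times)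
  then have "compact ({0..T} \<times> U \<times> V)" by (intro compact_Times U V compact_Icc)
  then obtain B where B: "\<And>x. x \<in> {0..T} \<times> U \<times> V \<Longrightarrow> \<bar>F x\<bar> \<le> B"
    using continuous_on_compact_bounded[OF _ F] by metis
  have "e / 2 > 0" using e by simp
  obtain X where X: "s0 \<in> X" "open X"
    "\<forall>s\<in>X \<inter> {0..T}. \<forall>x\<in>U \<times> V. dist (F (s, x)) (F (s0, x)) \<le> e / 2"
    by (rule continuous_on_prod_compactE[OF F cUV s0 \<open>e / 2 > 0\<close>])
  have "dist (hamiltonian U V Q h i s (w s)) (hamiltonian U V Q h i s0 (w s0)) < e"
    if s: "s \<in> X" "s \<in> {0..T}" for s
  proof -
    have "\<bar>minmax U V (pre_hamiltonian Q h s i (w s)) - minmax U V (pre_hamiltonian Q h s0 i (w s0))\<bar> \<le> e / 2"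
    proof (rule minmax_nonexpansive[OF U(2) V(2)])
      fix u v assume uv: "u \<in> U" "v \<in> V"
      show "\<bar>pre_hamiltonian Q h s i (w s) u v\<bar> \<le> B" using B[of "(s, u, v)"] uv s by (simp add: F_def)
      have "dist (F (s, (u, v))) (F (s0, (u, v))) \<le> e / 2" using X(3) s uv by blast
      then show "\<bar>pre_hamiltonian Q h s i (w s) u v - pre_hamiltonian Q h s0 i (w s0) u v\<bar> \<le> e / 2"
        by (simp add: F_def dist_real_def)
    qed
    then show ?thesis using e by (simp add: hamiltonian_def dist_real_def)
  qed
  then show "\<forall>\<^sub>F s in at s0 within {0..T}.
      dist (hamiltonian U V Q h i s (w s)) (hamiltonian U V Q h i s0 (w s0)) < e"
    unfolding eventually_at_topological using X(1,2) by blast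
qed

lemma hamiltonian_lipschitz:
  fixes U :: "'u::topological_space set" and V :: "'v::topological_space set"
    and Q :: "real \<Rightarrow> 'u \<Rightarrow> 'v \<Rightarrow> real ^ 'd::finite ^ 'd"
  assumes U: "compact U" "U \<noteq> {}" and V: "compact V" "V \<noteq> {}"
    and Q: "\<And>i j. continuous_on ({0..T} \<times> U \<times> V) (\<lambda>(t, u, v). Q t u v $ i $ j)"
    and h: "\<And>i. continuous_on ({0..T} \<times> U \<times> V) (\<lambda>(t, u, v). h t i u v)"
  shows "\<exists>K>0. \<forall>i. \<forall>s\<in>{0..T}. \<forall>w w'.
    \<bar>hamiltonian U V Q h i s w - hamiltonian U V Q h i s w'\<bar> \<le> K * norm (w - w')"
proof -
  have comp: "compact ({0..T} \<times> U \<times> V)" using U V by (intro compact_Times) auto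
  have "\<exists>B\<ge>0. \<forall>x\<in>{0..T} \<times> U \<times> V. \<bar>case x of (t, u, v) \<Rightarrow> Q t u v $ i $ j\<bar> \<le> B" for i j
    using continuous_on_compact_bounded[OF comp Q] by metis
  then obtain B where B0: "\<And>i j. B i j \<ge> 0"
    and B: "\<And>i j x. x \<in> {0..T} \<times> U \<times> V \<Longrightarrow> \<bar>case x of (t, u, v) \<Rightarrow> Q t u v $ i $ j\<bar> \<le> B i j"
    by metis
  \<comment> \<open>the summand 1 keeps \<open>K\<close> positive\<close>
  define K where "K = 1 + (\<Sum>i\<in>UNIV. \<Sum>j\<in>UNIV. B i j)"
  show ?thesis
  proof (intro exI[of _ K] conjI allI ballI)
    show "K > 0" unfolding K_def by (intro add_pos_nonneg sum_nonneg B0) auto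
    fix i s and w w' :: "real ^ 'd" assume s: "s \<in> {0..T}"
    have "continuous_on ({0..T} \<times> U \<times> V) (\<lambda>(t, u, v). pre_hamiltonian Q h t i w u v)"
      using pre_hamiltonian_continuous[OF Q h continuous_on_const] .
    then obtain M where M: "\<And>x. x \<in> {0..T} \<times> U \<times> V \<Longrightarrow>
        \<bar>case x of (t, u, v) \<Rightarrow> pre_hamiltonian Q h t i w u v\<bar> \<le> M"
      using continuous_on_compact_bounded[OF comp] by metis
    show "\<bar>hamiltonian U V Q h i s w - hamiltonian U V Q h i s w'\<bar> \<le> K * norm (w - w')"
      unfolding hamiltonian_def
    proof (rule minmax_nonexpansive[OF U(2) V(2)])
      fix u v assume uv: "u \<in> U" "v \<in> V"
      show "\<bar>pre_hamiltonian Q h s i w u v\<bar> \<le> M" using M[of "(s, u, v)"] s uv by simp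
      have "\<bar>pre_hamiltonian Q h s i w u v - pre_hamiltonian Q h s i w' u v\<bar>
          = \<bar>\<Sum>j\<in>UNIV. Q s u v $ i $ j * (w - w') $ j\<bar>"
        by (simp add: pre_hamiltonian_def right_diff_distrib sum_subtractf)
      also have "\<dots> \<le> (\<Sum>j\<in>UNIV. \<bar>Q s u v $ i $ j * (w - w') $ j\<bar>)" by (rule sum_abs)
      also have "\<dots> \<le> (\<Sum>j\<in>UNIV. B i j * norm (w - w'))"
        unfolding abs_mult using B[of "(s, u, v)"] s uv
        by (intro sum_mono mult_mono component_le_norm_cart B0) auto
      also have "\<dots> = (\<Sum>j\<in>UNIV. B i j) * norm (w - w')" by (simp add: sum_distrib_right)
      also have "\<dots> \<le> K * norm (w - w')"
      proof (rule mult_right_mono)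
        have "(\<Sum>j\<in>UNIV. B i j) \<le> (\<Sum>i\<in>UNIV. \<Sum>j\<in>UNIV. B i j)"
          by (rule member_le_sum) (auto intro: sum_nonneg B0)
        then show "(\<Sum>j\<in>UNIV. B i j) \<le> K" by (simp add: K_def)
      qed simp
      finally show "\<bar>pre_hamiltonian Q h s i w u v - pre_hamiltonian Q h s i w' u v\<bar> \<le> K * norm (w - w')" .
    qed
  qed
qed

section \<open>Existence and uniqueness\<close>

theorem mainTheorem2:
  fixes T :: real
    and U :: "'u::topological_space set"
    and V :: "'v::topological_space set"
    and Q :: "real \<Rightarrow> 'u \<Rightarrow> 'v \<Rightarrow> real ^ 'd::finite ^ 'd"
    and g :: "real \<Rightarrow> 'd \<Rightarrow> real"
    and h :: "real \<Rightarrow> 'd \<Rightarrow> 'u \<Rightarrow> 'v \<Rightarrow> real"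
  assumes T_pos: "T > 0"
    and U_compact: "compact U" "U \<noteq> {}"
    and V_compact: "compact V" "V \<noteq> {}"
    and Q_kolmogorov: "\<And>t u v. t \<in> {0..T} \<Longrightarrow> u \<in> U \<Longrightarrow> v \<in> V \<Longrightarrow> kolmogorov_matrix (Q t u v)"
    and Q_continuous: "\<And>i j. continuous_on ({0..T} \<times> U \<times> V) (\<lambda>(t, u, v). Q t u v $ i $ j)"
    and g_continuous: "\<And>i. continuous_on {0..T} (\<lambda>t. g t i)"
    and h_continuous: "\<And>i. continuous_on ({0..T} \<times> U \<times> V) (\<lambda>(t, u, v). h t i u v)"
    and g_lipschitz: "\<And>i. \<exists>L. L-lipschitz_on {0..T} (\<lambda>t. g t i)"
    and isaacs: "\<And>t i w. t \<in> {0..T} \<Longrightarrow>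
        minmax U V (pre_hamiltonian Q h t i w) = maxmin U V (pre_hamiltonian Q h t i w)"
  shows "\<exists>!\<phi>. \<phi> \<in> AC T \<and> zachrisson_solution T U V Q h g \<phi>"
proof -
  let ?H = "hamiltonian U V Q h"
  obtain K where K: "K > 0"
    and lip': "\<forall>i. \<forall>s\<in>{0..T}. \<forall>w w'. \<bar>?H i s w - ?H i s w'\<bar> \<le> K * norm (w - w')"
    using hamiltonian_lipschitz[where h = h, OF U_compact V_compact Q_continuous h_continuous]
    by (elim exE conjE)
  have lip: "\<bar>?H i s w - ?H i s w'\<bar> \<le> K * norm (w - w')" if "s \<in> {0..T}" for i s w w'
    using lip' that by blast
  have cont: "continuous_on {0..T} (\<lambda>s. ?H i s (w s))" if "continuous_on {0..T} w" for i w
    by (rule hamiltonian_continuous[where h = h, OF U_compact V_compact Q_continuous h_continuous that])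
  define fp where "fp w \<longleftrightarrow> (\<forall>t\<in>{0..T}. \<forall>i. w t $ i = stopping_value T (\<lambda>s. g s i) (\<lambda>s. ?H i s (w s)) t)"
    for w :: "real \<Rightarrow> real ^ 'd"
  note fixed_point = stopping_value_system_fixed_point[of T K ?H g, OF T_pos K cont lip g_lipschitz,
      folded fp_def]
  have sol_iff: "zachrisson_solution T U V Q h g \<phi> \<longleftrightarrow>
      (\<forall>i. obstacle_solution T (\<lambda>s. g s i) (\<lambda>s. ?H i s (\<chi> j. \<phi> s j)) (\<lambda>s. \<phi> s i))" for \<phi>
    unfolding zachrisson_solution_def obstacle_solution_def by simp
  have sol_imp: "continuous_on {0..T} (\<lambda>s. \<chi> j. \<phi> s j) \<and> fp (\<lambda>s. \<chi> j. \<phi> s j)"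
    if \<phi>: "\<phi> \<in> AC T" "zachrisson_solution T U V Q h g \<phi>" for \<phi>
  proof
    have ac: "absolutely_continuous_on {0..T} (\<lambda>s. \<phi> s i)" for i using \<phi>(1) by (simp add: AC_def)
    then show c: "continuous_on {0..T} (\<lambda>s. \<chi> j. \<phi> s j)"
      by (intro continuous_on_vec_lambda absolutely_continuous_on_imp_continuous_on)
    show "fp (\<lambda>s. \<chi> j. \<phi> s j)"
      unfolding fp_def vec_lambda_beta
    proof (intro ballI allI)
      fix t i assume t: "t \<in> {0..T}"
      have sol: "obstacle_solution T (\<lambda>s. g s i) (\<lambda>s. ?H i s (\<chi> j. \<phi> s j)) (\<lambda>s. \<phi> s i)"
        using \<phi>(2) unfolding sol_iff by blast
      show "\<phi> t i = stopping_value T (\<lambda>s. g s i) (\<lambda>s. ?H i s (\<chi> j. \<phi> s j)) t"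
        using obstacle_solution_imp_stopping_value[OF cont[OF c] g_continuous ac sol] t by simp
    qed
  qed
  obtain w where w: "continuous_on {0..T} w" "fp w" using fixed_point(1) by blast
  define \<phi> where "\<phi> = restrict (\<lambda>t i. w t $ i) {0..T}"
  have \<phi>w: "(\<chi> j. \<phi> t j) = w t" if "t \<in> {0..T}" for t using that by (simp add: \<phi>_def)
  have c: "continuous_on {0..T} (\<lambda>s. \<chi> j. \<phi> s j)"
    by (rule iffD2[OF continuous_on_cong[OF refl \<phi>w] w(1)])
  have val: "\<phi> t i = stopping_value T (\<lambda>s. g s i) (\<lambda>s. ?H i s (\<chi> j. \<phi> s j)) t" if t: "t \<in> {0..T}" for t i
  proof -
    have "\<phi> t i = stopping_value T (\<lambda>s. g s i) (\<lambda>s. ?H i s (w s)) t"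
      using w(2) t by (simp add: fp_def \<phi>_def)
    also have "\<dots> = stopping_value T (\<lambda>s. g s i) (\<lambda>s. ?H i s (\<chi> j. \<phi> s j)) t"
      using t \<phi>w by (intro stopping_value_cong) auto
    finally show ?thesis .
  qed
  show ?thesis
  proof (rule ex1I[of _ \<phi>])
    have "absolutely_continuous_on {0..T} (\<lambda>s. \<phi> s i)
        \<and> obstacle_solution T (\<lambda>s. g s i) (\<lambda>s. ?H i s (\<chi> j. \<phi> s j)) (\<lambda>s. \<phi> s i)" for i
    proof -
      obtain L where L: "L-lipschitz_on {0..T} (\<lambda>t. g t i)" using g_lipschitz by blast
      show ?thesis
        using stopping_value_imp_obstacle_solution[OF T_pos cont[OF c] L val] by blast
    qed
    then show "\<phi> \<in> AC T \<and> zachrisson_solution T U V Q h g \<phi>"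
      unfolding sol_iff by (auto simp: AC_def \<phi>_def)
    fix \<psi> assume \<psi>: "\<psi> \<in> AC T \<and> zachrisson_solution T U V Q h g \<psi>"
    have "\<psi> t = \<phi> t" if t: "t \<in> {0..T}" for t
    proof
      fix i
      have "(\<chi> j. \<psi> t j) = w t"
        using sol_imp[of \<psi>] \<psi> w t by (intro fixed_point(2)) auto
      then have "(\<chi> j. \<psi> t j) $ i = w t $ i" by simp
      then show "\<psi> t i = \<phi> t i" using t by (simp add: \<phi>_def)
    qed
    moreover have "\<psi> \<in> extensional {0..T}" "\<phi> \<in> extensional {0..T}"
      using \<psi> by (auto simp: AC_def \<phi>_def)
    ultimately show "\<psi> = \<phi>" using extensionalityI[of \<psi> "{0..T}" \<phi>] by blast
  qed
qed

end
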